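(* Let $K$ be a field, $S=K[x_1,\ldots,x_n]$, and let $I\subset S$ be a monomial ideal. (a) The following conditions are equivalent: (i) $I$ is an intersection of powers of monomial prime ideals; (ii) for all $\mathfrak p\in\operatorname{Ass}(S/I)$ there exist positive integers $a_{\mathfrak p}$ such that $I(\mathfrak p)=\widetilde{I(\mathfrak p)}\cap \mathfrak m_{\mathfrak p}^{a_{\mathfrak p}}$; (iii) $\min(I(\mathfrak p))>\max(\operatorname{Soc}(S(\mathfrak p)/I(\mathfrak p)))$ for all $\mathfrak p\in\operatorname{Ass}(S/I)$. (b) Let $I=\bigcap_{i=1}^r\mathfrak p_i^{d_i}$ be an irredundant presentation of $I$ as an intersection of powers of monomial prime ideals. Then $\operatorname{Ass}(S/I)=\{\mathfrak p_1,\ldots,\mathfrak p_r\}$ and $d_i=\max(\operatorname{Soc}(S(\mathfrak p_i)/I(\mathfrak p_i)))+1$ for all $i=1,\ldots,r$.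
   Context: A monomial prime ideal of $S=K[x_1,\ldots,x_n]$ is a prime ideal generated by a subset of the variables. All associated primes of $S/I$, for $I$ a monomial ideal, are monomial prime ideals. A presentation $I=\bigcap_{i=1}^r\mathfrak p_i^{d_i}$ is irredundant if no $\mathfrak p_i^{d_i}$ can be omitted from the intersection. For a monomial prime ideal $\mathfrak p$, $S(\mathfrak p)$ denotes the polynomial ring over $K$ in the variables which belong to $\mathfrak p$, and $\mathfrak m_{\mathfrak p}$ its graded maximal ideal (generated by these variables). The monomial localization $I(\mathfrak p)\subset S(\mathfrak p)$ is the image of $I$ under the $K$-algebra homomorphism $\varphi\colon S\to S(\mathfrak p)$ with $\varphi(x_i)=x_i$ if $x_i\in\mathfrak p$ and $\varphi(x_i)=1$ otherwise. The saturation of $I(\mathfrak p)$ is $\widetilde{I(\mathfrak p)}=\bigcup_{k}\left(I(\mathfrak p):\mathfrak m_{\mathfrak p}^k\right)$. The socle is $\operatorname{Soc}(S(\mathfrak p)/I(\mathfrak p))=(I(\mathfrak p):\mathfrak m_{\mathfrak p})/I(\mathfrak p)$, a finite-dimensional graded $K$-vector space. For $\mathfrak p\in \operatorname{Ass}(S/I)$ put $\max(\operatorname{Soc}(S(\mathfrak p)/I(\mathfrak p)))=\max\{i : (\operatorname{Soc}(S(\mathfrak p)/I(\mathfrak p)))_i\neq 0\}$, and for any finitely generated graded $S(\mathfrak p)$-module $M$ put $\min(M)=\min\{i : M_i\neq0\}$. Gradings are the standard ones with $\deg x_i=1$.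
   Formalization: In (b), the formula for d_i is stated only for I ≠ 0; for I = (0) it fails, since (0) = (0)^2 is an irredundant presentation while max(Soc)+1 = 1. All other claims cover every monomial ideal. *)

theory Defs
  imports
    "HOL-Library.Poly_Mapping"
    "HOL-Library.Extended_Nat"
    "HOL-Algebra.QuotRing"
    "HOL-Algebra.Ideal_Product"
begin

section \<open>Polynomial rings in subsets of the variables\<close>

text \<open>
  A polynomial over \<open>'k\<close> in variables indexed by \<open>'x\<close> is a finitely supported map from exponent
  vectors to coefficients.  The whole type (for a finite \<open>'x\<close>) is \<open>K[x\<^sub>1, \<dots>, x\<^sub>n]\<close> with
  \<open>n = CARD('x)\<close>.
\<close>

type_synonym ('x, 'k) mpoly = "('x \<Rightarrow>\<^sub>0 nat) \<Rightarrow>\<^sub>0 'k"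

definition const :: "'k \<Rightarrow> ('x, 'k::zero) mpoly"
  where "const c = Poly_Mapping.single 0 c"

definition var :: "'x \<Rightarrow> ('x, 'k::zero_neq_one) mpoly"
  where "var i = Poly_Mapping.single (Poly_Mapping.single i 1) 1"

definition monomials :: "('x, 'k::zero_neq_one) mpoly set"
  where "monomials = {Poly_Mapping.single m 1 | m. True}"

definition mdeg :: "('x \<Rightarrow>\<^sub>0 nat) \<Rightarrow> nat"
  where "mdeg m = (\<Sum>i\<in>Poly_Mapping.keys m. Poly_Mapping.lookup m i)"

text \<open>The zero polynomial is homogeneous of every degree.\<close>

definition homogeneous :: "nat \<Rightarrow> ('x, 'k::zero) mpoly \<Rightarrow> bool"
  where "homogeneous d f \<longleftrightarrow> (\<forall>m\<in>Poly_Mapping.keys f. mdeg m = d)"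

text \<open>The subring of polynomials in the variables indexed by \<open>A\<close>, as a ring in its own right.\<close>

definition polyring :: "'x set \<Rightarrow> ('x, 'k::comm_ring_1) mpoly ring"
  where "polyring A =
    \<lparr>carrier = {f. \<forall>m\<in>Poly_Mapping.keys f. Poly_Mapping.keys m \<subseteq> A},
     mult = (*), one = 1, zero = 0, add = (+)\<rparr>"

lemma cring_polyring: "cring (polyring A :: ('x, 'k::comm_ring_1) mpoly ring)"
proof -
  define C where "C = {f :: ('x, 'k) mpoly. \<forall>m\<in>Poly_Mapping.keys f. Poly_Mapping.keys m \<subseteq> A}"
  have R: "polyring A = \<lparr>carrier = C, mult = (*), one = 1, zero = 0, add = (+)\<rparr>"
    by (simp add: polyring_def C_def)
  have zero: "0 \<in> C" and one: "1 \<in> C"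
    by (simp_all add: C_def)
  have add: "f + g \<in> C" if "f \<in> C" "g \<in> C" for f g
    using that Poly_Mapping.keys_add[of f g] unfolding C_def by blast
  have uminus: "- f \<in> C" if "f \<in> C" for f
    using that by (simp add: C_def keys_minus)
  have mult: "f * g \<in> C" if "f \<in> C" "g \<in> C" for f g
  proof -
    have "Poly_Mapping.keys m \<subseteq> A" if m: "m \<in> Poly_Mapping.keys (f * g)" for m
    proof -
      obtain a b where "m = a + b" "a \<in> Poly_Mapping.keys f" "b \<in> Poly_Mapping.keys g"
        using m Poly_Mapping.keys_mult[of f g] by blast
      then show ?thesis
        using \<open>f \<in> C\<close> \<open>g \<in> C\<close> Poly_Mapping.keys_add[of a b] unfolding C_def by blast
    qed
    then show ?thesis by (simp add: C_def)
  qed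
  have "\<exists>g\<in>C. g + f = 0" if "f \<in> C" for f
    using uminus[OF that] by (intro bexI[of _ "- f"]) simp_all
  then have "abelian_group (polyring A :: ('x, 'k) mpoly ring)"
    by (intro abelian_groupI) (simp_all add: R zero add ac_simps)
  moreover have "Group.comm_monoid (polyring A :: ('x, 'k) mpoly ring)"
    by (intro comm_monoidI) (simp_all add: R one mult ac_simps)
  ultimately show ?thesis
    by (intro cringI) (simp_all add: R distrib_right)
qed

definition poly_eval :: "('x \<Rightarrow> ('y, 'k) mpoly) \<Rightarrow> ('x, 'k::comm_ring_1) mpoly \<Rightarrow> ('y, 'k) mpoly"
  where "poly_eval g f =
    (\<Sum>m\<in>Poly_Mapping.keys f.
       const (Poly_Mapping.lookup f m) *
       (\<Prod>i\<in>Poly_Mapping.keys m. g i ^ Poly_Mapping.lookup m i))"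

section \<open>Ideals\<close>

text \<open>
  \<open>ideals_set R\<close> has \<open>carrier R\<close> as its unit and the product of ideals as its multiplication, so that
  the zeroth power of an ideal is the whole ring.
\<close>

abbreviation ideal_power :: "('a, 'b) ring_scheme \<Rightarrow> 'a set \<Rightarrow> nat \<Rightarrow> 'a set"
  where "ideal_power R I d \<equiv> I [^]\<^bsub>ideals_set R\<^esub> d"

definition ideal_colon :: "('a, 'b) ring_scheme \<Rightarrow> 'a set \<Rightarrow> 'a set \<Rightarrow> 'a set"
  where "ideal_colon R I J = {f \<in> carrier R. \<forall>g\<in>J. f \<otimes>\<^bsub>R\<^esub> g \<in> I}"

definition ideal_saturation :: "('a, 'b) ring_scheme \<Rightarrow> 'a set \<Rightarrow> 'a set \<Rightarrow> 'a set"
  where "ideal_saturation R I \<mm> = (\<Union>k::nat. ideal_colon R I (ideal_power R \<mm> k))"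

text \<open>
  The associated primes of the \<open>R\<close>-module \<open>R/I\<close>: the prime ideals that are annihilators of elements
  of \<open>R/I\<close>.  The scalar multiple of a class \<open>c\<close> by \<open>s\<close> is the product of the class of \<open>s\<close> with \<open>c\<close>.
\<close>

definition Ass :: "('a, 'b) ring_scheme \<Rightarrow> 'a set \<Rightarrow> 'a set set"
  where "Ass R I =
    {P. primeideal P R \<and>
        (\<exists>c\<in>carrier (R Quot I).
           P = {s \<in> carrier R. (I +>\<^bsub>R\<^esub> s) \<otimes>\<^bsub>R Quot I\<^esub> c = \<zero>\<^bsub>R Quot I\<^esub>})}"

definition monomial_ideal :: "('x, 'k::comm_ring_1) mpoly set \<Rightarrow> bool"
  where "monomial_ideal I \<longleftrightarrow> (\<exists>G\<subseteq>monomials. I = Idl\<^bsub>polyring UNIV\<^esub> G)"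

text \<open>The set of generating variables may be empty, in which case the prime ideal is zero.\<close>

definition monomial_prime_ideal :: "('x, 'k::comm_ring_1) mpoly set \<Rightarrow> bool"
  where "monomial_prime_ideal P \<longleftrightarrow>
    primeideal P (polyring UNIV) \<and> (\<exists>A. P = Idl\<^bsub>polyring UNIV\<^esub> (var ` A))"

section \<open>Monomial localization\<close>

definition vars_in :: "('x, 'k::comm_ring_1) mpoly set \<Rightarrow> 'x set"
  where "vars_in P = {i. var i \<in> P}"

abbreviation loc_ring :: "('x, 'k::comm_ring_1) mpoly set \<Rightarrow> ('x, 'k) mpoly ring"
  where "loc_ring P \<equiv> polyring (vars_in P)"

definition loc_max_ideal :: "('x, 'k::comm_ring_1) mpoly set \<Rightarrow> ('x, 'k) mpoly set"
  where "loc_max_ideal P = Idl\<^bsub>loc_ring P\<^esub> (var ` vars_in P)"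

definition loc_ideal :: "('x, 'k::comm_ring_1) mpoly set \<Rightarrow> ('x, 'k) mpoly set \<Rightarrow> ('x, 'k) mpoly set"
  where "loc_ideal I P = poly_eval (\<lambda>i. if i \<in> vars_in P then var i else 1) ` I"

definition loc_saturation ::
  "('x, 'k::comm_ring_1) mpoly set \<Rightarrow> ('x, 'k) mpoly set \<Rightarrow> ('x, 'k) mpoly set"
  where "loc_saturation I P = ideal_saturation (loc_ring P) (loc_ideal I P) (loc_max_ideal P)"

section \<open>Socle and extremal degrees\<close>

text \<open>The socle consists of cosets; it is a subset of the carrier of the quotient ring.\<close>

definition soc ::
  "('x, 'k::comm_ring_1) mpoly set \<Rightarrow> ('x, 'k) mpoly set \<Rightarrow> ('x, 'k) mpoly set set"
  where "soc I P =
    (\<lambda>f. loc_ideal I P +>\<^bsub>loc_ring P\<^esub> f) `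
      ideal_colon (loc_ring P) (loc_ideal I P) (loc_max_ideal P)"

text \<open>The degree \<open>d\<close> component: the socle elements represented by a form of degree \<open>d\<close>.\<close>

definition soc_component ::
  "('x, 'k::comm_ring_1) mpoly set \<Rightarrow> ('x, 'k) mpoly set \<Rightarrow> nat \<Rightarrow> ('x, 'k) mpoly set set"
  where "soc_component I P d =
    {c \<in> soc I P. \<exists>f\<in>carrier (loc_ring P). homogeneous d f \<and> c = loc_ideal I P +>\<^bsub>loc_ring P\<^esub> f}"

text \<open>Meaningful for \<open>P \<in> Ass(S/I)\<close>, where the set of degrees is finite and nonempty.\<close>

definition max_soc :: "('x, 'k::comm_ring_1) mpoly set \<Rightarrow> ('x, 'k) mpoly set \<Rightarrow> nat"
  where "max_soc I P =
    Max {d. soc_component I P d \<noteq> {\<zero>\<^bsub>loc_ring P Quot loc_ideal I P\<^esub>}}"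

text \<open>The least degree of a nonzero form in a graded ideal, with value \<open>\<infinity>\<close> for the zero ideal.\<close>

definition min_degree :: "('x, 'k::comm_ring_1) mpoly set \<Rightarrow> enat"
  where "min_degree J = Inf (enat ` {d. {f \<in> J. homogeneous d f} \<noteq> {0}})"

section \<open>Intersections of powers of monomial prime ideals\<close>

text \<open>For \<open>r = 0\<close> the intersection is the whole ring.\<close>

definition power_intersection ::
  "('x, 'k::comm_ring_1) mpoly set \<Rightarrow> nat \<Rightarrow> (nat \<Rightarrow> ('x, 'k) mpoly set) \<Rightarrow> (nat \<Rightarrow> nat) \<Rightarrow> bool"
  where "power_intersection I r p d \<longleftrightarrow>
    (\<forall>i\<in>{1..r}. monomial_prime_ideal (p i)) \<and>
    I = (\<Inter>i\<in>{1..r}. ideal_power (polyring UNIV) (p i) (d i))"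

definition irredundant_power_intersection ::
  "('x, 'k::comm_ring_1) mpoly set \<Rightarrow> nat \<Rightarrow> (nat \<Rightarrow> ('x, 'k) mpoly set) \<Rightarrow> (nat \<Rightarrow> nat) \<Rightarrow> bool"
  where "irredundant_power_intersection I r p d \<longleftrightarrow>
    power_intersection I r p d \<and>
    (\<forall>j\<in>{1..r}. I \<noteq> (\<Inter>i\<in>{1..r} - {j}. ideal_power (polyring UNIV) (p i) (d i)))"

end

theory Submission
  imports Defs
begin

text \<open>
  A monomial ideal \<open>I\<close> is the span of the monomials whose exponents lie in an up-closed set \<open>N\<close>, and
  every construction in the theorem (powers of monomial primes, localization, colon ideals,
  saturation, socle) sends spans of monomials to spans of monomials.  So the theorem is a statement
  about \<open>N\<close>.  For a set \<open>A\<close> of variables let \<open>deg\<^sub>A\<close> be the degree in these variables.  The power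
  \<open>\<pp>\<^sub>A\<^sup>d\<close> of the prime generated by \<open>A\<close> is spanned by the exponents with \<open>deg\<^sub>A \<ge> d\<close>.  Localizing at
  \<open>\<pp>\<^sub>A\<close> gives \<open>N\<^sub>A\<close> (\<open>local_exps\<close>): the exponents in \<open>A\<close> that enter \<open>N\<close> after adding something off
  \<open>A\<close>.  The socle is spanned by \<open>Soc\<^sub>A\<close> (\<open>socle_exps\<close>): the exponents outside \<open>N\<^sub>A\<close> that enter it with
  one more factor of any variable in \<open>A\<close>.

  The associated primes are the \<open>\<pp>\<^sub>A\<close> with \<open>Soc\<^sub>A \<noteq> \<emptyset>\<close> (\<open>Ass_poly_span\<close>).  The main point is that an
  annihilator \<open>P = I : f\<close> that is prime is spanned by monomials.  If \<open>g \<in> P\<close>, some product of a term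
  \<open>v\<close> of \<open>g\<close> and a term \<open>u \<notin> N\<close> of \<open>f\<close> arises in only one way, so it cannot cancel in \<open>g f\<close> and lies
  in \<open>I\<close>.  If \<open>v \<in> P\<close> it can be removed from \<open>g\<close>; otherwise \<open>f\<close> may be replaced by \<open>v f\<close>, which has
  the same annihilator and fewer terms outside \<open>I\<close>.

  Conditions (i), (ii) and (iii) are each equivalent to: every element of \<open>N\<^sub>A\<close> has larger degree
  than every element of \<open>Soc\<^sub>A\<close>, for all \<open>A\<close>.  For (iii) this is the definition, once \<open>Soc\<^sub>A\<close> is known
  to be finite; it is an antichain, so Dickson's lemma applies (\<open>finite_socle_exps\<close>).

  For (ii), socle elements lie in the saturation, so the cut-off degree \<open>a\<close> must lie strictly above
  \<open>Soc\<^sub>A\<close> and must not exceed the degrees in \<open>N\<^sub>A\<close>.  Conversely \<open>a = max deg Soc\<^sub>A + 1\<close> works, because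
  an element of the saturation outside \<open>N\<^sub>A\<close> can be multiplied until it reaches the socle, and so
  its degree is below \<open>a\<close> (\<open>local_exps_eq_sat_cut_iff\<close>).

  For (i), suppose \<open>N\<close> is the intersection of the conditions \<open>deg\<^bsub>B\<^sub>j\<^esub> \<ge> d\<^sub>j\<close>.  Then \<open>N\<^sub>A\<close> is cut out by
  those with \<open>B\<^sub>j \<subseteq> A\<close>.  A socle element violates one of them; multiplying by a variable of \<open>A\<close>
  outside \<open>B\<^sub>j\<close> would not repair this, so \<open>B\<^sub>j = A\<close>, and \<open>d\<^sub>j\<close> separates the degrees of \<open>Soc\<^sub>A\<close> from
  those of \<open>N\<^sub>A\<close>.  Conversely, if the degrees are separated, then \<open>N\<close> is the intersection of the
  conditions \<open>deg\<^sub>A > max deg Soc\<^sub>A\<close> over the associated \<open>\<pp>\<^sub>A\<close>: given \<open>m \<notin> N\<close>, choose \<open>A\<close> minimal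
  such that the part of \<open>m\<close> in \<open>A\<close> is not in \<open>N\<^sub>A\<close>; by minimality this part has a multiple in
  \<open>Soc\<^sub>A\<close>, so \<open>m\<close> violates the condition for \<open>A\<close> (\<open>not_mem_imp_socle_exp\<close>).

  For (b), irredundancy gives for each \<open>j\<close> an \<open>m\<close> that violates only the \<open>j\<close>-th condition.  Its part
  in \<open>B\<^sub>j\<close>, raised to degree \<open>d\<^sub>j - 1\<close>, is a socle element, and the argument above shows that no
  socle element has larger degree (\<open>irredundant_socle_exp\<close>).
\<close>

section \<open>Exponent vectors and up-closed sets\<close>

definition exp_on :: "'x set \<Rightarrow> ('x \<Rightarrow> nat) \<Rightarrow> 'x \<Rightarrow>\<^sub>0 nat"
  where "exp_on A g = (\<Sum>i\<in>A. Poly_Mapping.single i (g i))"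

abbreviation restrict_exp :: "'x set \<Rightarrow> ('x \<Rightarrow>\<^sub>0 nat) \<Rightarrow> 'x \<Rightarrow>\<^sub>0 nat"
  where "restrict_exp A m \<equiv> exp_on A (Poly_Mapping.lookup m)"

definition unit_exp :: "'x \<Rightarrow> 'x \<Rightarrow>\<^sub>0 nat"
  where "unit_exp i = Poly_Mapping.single i 1"

definition exps :: "'x set \<Rightarrow> ('x \<Rightarrow>\<^sub>0 nat) set"
  where "exps A = {m. Poly_Mapping.keys m \<subseteq> A}"

definition deg_in :: "'x set \<Rightarrow> ('x \<Rightarrow>\<^sub>0 nat) \<Rightarrow> nat"
  where "deg_in A m = (\<Sum>i\<in>A. Poly_Mapping.lookup m i)"

definition upset :: "'x set \<Rightarrow> ('x \<Rightarrow>\<^sub>0 nat) set \<Rightarrow> bool"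
  where "upset A M \<longleftrightarrow> M \<subseteq> exps A \<and> (\<forall>m\<in>M. \<forall>w\<in>exps A. m + w \<in> M)"

text \<open>The exponents of the monomials in \<open>I(\<pp>)\<close>, for the prime \<open>\<pp>\<close> generated by \<open>A\<close>.\<close>

definition local_exps :: "('x \<Rightarrow>\<^sub>0 nat) set \<Rightarrow> 'x set \<Rightarrow> ('x \<Rightarrow>\<^sub>0 nat) set"
  where "local_exps N A = {m \<in> exps A. \<exists>v\<in>exps (- A). m + v \<in> N}"

text \<open>The exponents of the monomials that represent a basis of the socle of \<open>S(\<pp>)/I(\<pp>)\<close>.\<close>

definition socle_exps :: "('x \<Rightarrow>\<^sub>0 nat) set \<Rightarrow> 'x set \<Rightarrow> ('x \<Rightarrow>\<^sub>0 nat) set"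
  where "socle_exps N A =
    {m \<in> exps A - local_exps N A. \<forall>i\<in>A. m + unit_exp i \<in> local_exps N A}"

lemma lookup_exp_on [simp]:
  fixes A :: "'x::finite set"
  shows "Poly_Mapping.lookup (exp_on A g) i = (if i \<in> A then g i else 0)"
  by (simp add: exp_on_def lookup_sum lookup_single when_def sum.delta)

lemma lookup_unit_exp [simp]: "Poly_Mapping.lookup (unit_exp i) j = (if i = j then 1 else 0)"
  by (simp add: unit_exp_def lookup_single when_def)

lemma exps_iff: "m \<in> exps A \<longleftrightarrow> (\<forall>i. i \<notin> A \<longrightarrow> Poly_Mapping.lookup m i = 0)"
  unfolding exps_def by (auto simp: in_keys_iff)

lemma exps_UNIV [simp]: "exps UNIV = UNIV"
  by (simp add: exps_def)

lemma zero_in_exps [simp]: "0 \<in> exps A"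
  by (simp add: exps_iff)

lemma add_in_exps_iff [simp]: "m + w \<in> exps A \<longleftrightarrow> m \<in> exps A \<and> w \<in> exps A"
  by (auto simp: exps_iff lookup_add)

lemma unit_exp_in_exps [simp]: "unit_exp i \<in> exps A \<longleftrightarrow> i \<in> A"
  by (auto simp: exps_iff)

lemma exp_on_in_exps:
  fixes A :: "'x::finite set"
  assumes "B \<subseteq> A"
  shows "exp_on B g \<in> exps A"
  using assms by (auto simp: exps_iff)

lemma deg_in_zero [simp]: "deg_in A 0 = 0"
  by (simp add: deg_in_def)

lemma deg_in_add [simp]: "deg_in A (m + w) = deg_in A m + deg_in A w"
  by (simp add: deg_in_def lookup_add sum.distrib)

lemma deg_in_unit_exp [simp]:
  fixes A :: "'x::finite set"
  shows "deg_in A (unit_exp i) = (if i \<in> A then 1 else 0)"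
  by (simp add: deg_in_def)

lemma deg_in_eq_0:
  fixes A :: "'x::finite set"
  shows "deg_in A m = 0 \<longleftrightarrow> m \<in> exps (- A)"
  by (auto simp: deg_in_def exps_iff)

lemma lookup_le_deg_in:
  fixes A :: "'x::finite set"
  assumes "i \<in> A"
  shows "Poly_Mapping.lookup m i \<le> deg_in A m"
  unfolding deg_in_def using assms by (intro member_le_sum) auto

lemma mdeg_eq_deg_in:
  fixes A :: "'x::finite set"
  assumes "m \<in> exps A"
  shows "mdeg m = deg_in A m"
  unfolding mdeg_def deg_in_def using assms
  by (intro sum.mono_neutral_left) (auto simp: exps_def in_keys_iff)

lemma deg_in_restrict_exp [simp]:
  fixes A :: "'x::finite set"
  assumes "B \<subseteq> A"
  shows "deg_in B (restrict_exp A m) = deg_in B m"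
  unfolding deg_in_def using assms by (intro sum.cong) auto

lemma restrict_exp_add_Compl:
  fixes A :: "'x::finite set"
  shows "restrict_exp A m + restrict_exp (- A) m = m"
  by (rule poly_mapping_eqI) (simp add: lookup_add)

lemma restrict_exp_add:
  fixes A :: "'x::finite set"
  shows "restrict_exp A (m + w) = restrict_exp A m + restrict_exp A w"
  by (rule poly_mapping_eqI) (simp add: lookup_add)

lemma restrict_exp_in_exps:
  fixes A :: "'x::finite set"
  assumes "m \<in> exps A"
  shows "restrict_exp A m = m"
  using assms by (intro poly_mapping_eqI) (auto simp: exps_iff)

lemma restrict_exp_off:
  fixes A :: "'x::finite set"
  assumes "m \<in> exps (- A)"
  shows "restrict_exp A m = 0"
  using assms by (intro poly_mapping_eqI) (auto simp: exps_iff)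

lemma exp_splits_off_unit:
  fixes A :: "'x::finite set"
  assumes "deg_in A m > 0"
  obtains i w where "i \<in> A" "m = w + unit_exp i"
proof -
  obtain i where i: "i \<in> A" "Poly_Mapping.lookup m i > 0"
    using assms sum.neutral[of A "Poly_Mapping.lookup m"] unfolding deg_in_def by fastforce
  have "m = (m - unit_exp i) + unit_exp i"
    using i by (intro poly_mapping_eqI) (auto simp: lookup_add lookup_minus)
  with i that show thesis by blast
qed

lemma exp_le_imp_add:
  fixes m w :: "'x \<Rightarrow>\<^sub>0 nat"
  assumes "\<And>i. Poly_Mapping.lookup m i \<le> Poly_Mapping.lookup w i"
  shows "w = m + (w - m)"
  by (intro poly_mapping_eqI) (simp add: lookup_add lookup_minus assms)

lemma upsetD: "upset A M \<Longrightarrow> m \<in> M \<Longrightarrow> w \<in> exps A \<Longrightarrow> m + w \<in> M"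
  unfolding upset_def by blast

lemma upset_deg_ge: "upset A {m \<in> exps A. k \<le> deg_in B m}"
  unfolding upset_def by auto

lemma upset_local_exps:
  assumes "upset UNIV N"
  shows "upset A (local_exps N A)"
  unfolding upset_def
proof (intro conjI ballI)
  show "local_exps N A \<subseteq> exps A" by (auto simp: local_exps_def)
  fix m w assume m: "m \<in> local_exps N A" and w: "w \<in> exps A"
  then obtain v where v: "v \<in> exps (- A)" "m + v \<in> N" "m \<in> exps A"
    by (auto simp: local_exps_def)
  have "(m + w) + v \<in> N"
    using upsetD[OF assms v(2), of w] by (simp add: ac_simps)
  with v w show "m + w \<in> local_exps N A" by (auto simp: local_exps_def)
qed

lemma restrict_exp_in_local_exps:
  fixes N :: "('x::finite \<Rightarrow>\<^sub>0 nat) set"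
  assumes "m \<in> N"
  shows "restrict_exp A m \<in> local_exps N A"
  unfolding local_exps_def using assms
  by (auto intro!: exp_on_in_exps bexI[of _ "restrict_exp (- A) m"] simp: restrict_exp_add_Compl)

lemma local_exps_UNIV:
  assumes "upset UNIV N"
  shows "local_exps N UNIV = N"
proof -
  have "exps (- UNIV) = {0 :: 'a \<Rightarrow>\<^sub>0 nat}"
    by (auto simp: exps_def)
  then show ?thesis by (simp add: local_exps_def)
qed

section \<open>Finiteness of the socle\<close>

lemma nat_seq_mono_subseq:
  fixes s :: "nat \<Rightarrow> nat"
  shows "\<exists>f. strict_mono f \<and> incseq (\<lambda>n. s (f n))"
proof -
  obtain f where f: "strict_mono f" "monoseq (\<lambda>n. s (f n))"
    using seq_monosub by blast
  consider "incseq (\<lambda>n. s (f n))" | "decseq (\<lambda>n. s (f n))"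
    using f(2) by (auto simp: monoseq_iff)
  then show ?thesis
  proof cases
    case 1 then show ?thesis using f by blast
  next
    case 2
    obtain n where n: "\<And>k. s (f n) \<le> s (f k)"
      using ex_has_least_nat[of "\<lambda>_. True" 0 "\<lambda>n. s (f n)"] by auto
    have "s (f (n + k)) = s (f n)" for k
      using n[of "n + k"] decseqD[OF 2, of n "n + k"] by simp
    then have "incseq (\<lambda>k. s (f (n + k)))" by (simp add: incseq_def)
    moreover have "strict_mono (\<lambda>k. f (n + k))"
      using f(1) by (simp add: strict_mono_def)
    ultimately show ?thesis by blast
  qed
qed

text \<open>
  Dickson's lemma in the form: every sequence of exponent vectors has a subsequence that increases in
  each of finitely many coordinates, one coordinate being treated after the other.
\<close>

lemma dickson_subseq:
  fixes s :: "nat \<Rightarrow> 'x::finite \<Rightarrow>\<^sub>0 nat"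
  shows "\<exists>f. strict_mono f \<and> (\<forall>i\<in>B. incseq (\<lambda>n. Poly_Mapping.lookup (s (f n)) i))"
proof (induction B rule: finite_induct[OF finite])
  case 1
  show ?case by (auto intro: strict_mono_id)
next
  case (2 b B)
  then obtain f where f: "strict_mono f" "\<forall>i\<in>B. incseq (\<lambda>n. Poly_Mapping.lookup (s (f n)) i)"
    by blast
  obtain g where g: "strict_mono g" "incseq (\<lambda>n. Poly_Mapping.lookup (s (f (g n))) b)"
    using nat_seq_mono_subseq[of "\<lambda>n. Poly_Mapping.lookup (s (f n)) b"] by blast
  have "incseq (\<lambda>n. Poly_Mapping.lookup (s (f (g n))) i)" if "i \<in> B" for i
    using f(2) that strict_mono_mono[OF g(1)] unfolding mono_def by blast
  moreover have "strict_mono (\<lambda>n. f (g n))"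
    using f(1) g(1) by (simp add: strict_mono_def)
  ultimately show ?case using g(2) by (intro exI[of _ "\<lambda>n. f (g n)"]) auto
qed

text \<open>
  If one socle exponent properly divided another, then one more variable would already take it into
  the localized ideal, and with it its multiple.  So the socle exponents form an antichain.
\<close>

lemma finite_socle_exps:
  fixes N :: "('x::finite \<Rightarrow>\<^sub>0 nat) set"
  assumes "upset UNIV N"
  shows "finite (socle_exps N A)"
proof (rule ccontr)
  assume "infinite (socle_exps N A)"
  then obtain s :: "nat \<Rightarrow> _" where s: "inj s" "range s \<subseteq> socle_exps N A"
    using infinite_countable_subset by blast
  obtain f where f: "strict_mono f" "\<forall>i\<in>UNIV. incseq (\<lambda>n. Poly_Mapping.lookup (s (f n)) i)"
    using dickson_subseq[of UNIV s] by blast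
  define m m' w where "m = s (f 0)" and "m' = s (f 1)" and "w = m' - m"
  have m: "m \<in> socle_exps N A" and m': "m' \<in> socle_exps N A"
    using s by (auto simp: m_def m'_def)
  have m'w: "m' = m + w"
    unfolding w_def using f(2) by (intro exp_le_imp_add) (auto simp: m_def m'_def incseq_def)
  have "f 0 \<noteq> f 1" using f(1) by (simp add: strict_mono_eq)
  then have "m' \<noteq> m" using s(1) by (auto simp: m_def m'_def inj_eq)
  have wA: "w \<in> exps A" using m' m'w by (auto simp: socle_exps_def)
  moreover have "w \<noteq> 0" using \<open>m' \<noteq> m\<close> m'w by auto
  ultimately have "deg_in A w > 0"
    by (metis Compl_iff deg_in_eq_0 exps_iff gr0I lookup_zero poly_mapping_eqI)
  then obtain i w' where i: "i \<in> A" "w = w' + unit_exp i"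
    by (rule exp_splits_off_unit)
  have "(m + unit_exp i) + w' \<in> local_exps N A"
    using upsetD[OF upset_local_exps[OF assms]] m i wA by (simp add: socle_exps_def)
  then show False using m' m'w i by (simp add: socle_exps_def ac_simps)
qed

section \<open>Socle elements above exponents outside the ideal\<close>

text \<open>
  When the multiples of \<open>m\<close> outside the localized ideal have bounded degree, one of maximal degree is
  in the socle.
\<close>

lemma socle_exp_above:
  fixes N :: "('x::finite \<Rightarrow>\<^sub>0 nat) set"
  assumes "m \<in> exps A" "m \<notin> local_exps N A"
    and bound: "\<And>w. w \<in> exps A \<Longrightarrow> m + w \<notin> local_exps N A \<Longrightarrow> deg_in A w \<le> b"
  obtains w where "w \<in> exps A" "m + w \<in> socle_exps N A"
proof -
  let ?Q = "\<lambda>w. w \<in> exps A \<and> m + w \<notin> local_exps N A"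
  have "?Q 0" using assms by simp
  then obtain w where w: "?Q w" "\<And>w'. ?Q w' \<Longrightarrow> deg_in A w' \<le> deg_in A w"
    using ex_has_greatest_nat[of ?Q 0 "deg_in A" "Suc b"] bound by (metis less_Suc_eq_le)
  have "m + w + unit_exp i \<in> local_exps N A" if "i \<in> A" for i
    using w(1) w(2)[of "w + unit_exp i"] that by (auto simp: ac_simps)
  with w assms have "m + w \<in> socle_exps N A" by (auto simp: socle_exps_def)
  with w that show thesis by blast
qed

text \<open>
  Take \<open>A\<close> of least size such that the part of \<open>m\<close> in \<open>A\<close> is not in the localized ideal.  Dropping
  any \<open>i \<in> A\<close> puts it into the ideal, that is, some power of \<open>x\<^sub>i\<close> multiplies it into the ideal
  localized at \<open>A\<close>.  These powers bound the multiples that stay outside, so there is a socle element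
  above.
\<close>

lemma not_mem_imp_socle_exp:
  fixes N :: "('x::finite \<Rightarrow>\<^sub>0 nat) set"
  assumes up: "upset UNIV N" and "m \<notin> N"
  obtains A s where "s \<in> socle_exps N A" "deg_in A m \<le> deg_in A s"
proof -
  let ?Q = "\<lambda>A. restrict_exp A m \<notin> local_exps N A"
  have "?Q UNIV"
    using assms local_exps_UNIV[OF up] by (simp add: restrict_exp_in_exps)
  then obtain A where A: "?Q A" "\<And>B. ?Q B \<Longrightarrow> card A \<le> card B"
    using ex_has_least_nat[of ?Q UNIV card] by blast
  have "\<exists>t. restrict_exp A m + Poly_Mapping.single i t \<in> local_exps N A" if i: "i \<in> A" for i
  proof -
    have "\<not> ?Q (A - {i})"
      using A(2)[of "A - {i}"] i by (metis card_Diff1_less finite not_less)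
    then obtain v where v: "v \<in> exps (- (A - {i}))" "restrict_exp (A - {i}) m + v \<in> N"
      by (auto simp: local_exps_def)
    \<comment> \<open>The \<open>i\<close>-th coordinate of \<open>v\<close> is moved into \<open>A\<close>; the rest of \<open>v\<close> stays off \<open>A\<close>.\<close>
    have "restrict_exp A m + Poly_Mapping.single i (Poly_Mapping.lookup v i)
        + restrict_exp (- A) v =
      restrict_exp (A - {i}) m + v + Poly_Mapping.single i (Poly_Mapping.lookup m i)"
      using v(1) i by (intro poly_mapping_eqI)
        (auto simp: lookup_add lookup_single when_def exps_iff)
    also have "\<dots> \<in> N" using upsetD[OF up v(2)] by simp
    finally show ?thesis
      unfolding local_exps_def using i
      by (intro exI[of _ "Poly_Mapping.lookup v i"])
        (auto intro!: exp_on_in_exps simp: exps_iff lookup_add lookup_single when_def)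
  qed
  then obtain t where t: "\<And>i. i \<in> A \<Longrightarrow>
      restrict_exp A m + Poly_Mapping.single i (t i) \<in> local_exps N A"
    by metis
  \<comment> \<open>A multiplier whose \<open>i\<close>-th coordinate exceeds \<open>t i\<close> would lead into the ideal.\<close>
  have bound: "deg_in A w \<le> (\<Sum>i\<in>A. t i)"
    if w: "w \<in> exps A" "restrict_exp A m + w \<notin> local_exps N A" for w
    unfolding deg_in_def
  proof (rule sum_mono, rule ccontr)
    fix i assume i: "i \<in> A" "\<not> Poly_Mapping.lookup w i \<le> t i"
    define u where "u = w - Poly_Mapping.single i (t i)"
    have w': "w = Poly_Mapping.single i (t i) + u"
      unfolding u_def using i by (intro exp_le_imp_add) (auto simp: lookup_single when_def)
    then have "u \<in> exps A" using w(1) by simp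
    from upsetD[OF upset_local_exps[OF up] t[OF i(1)] this] w(2) w'
    show False by (simp add: ac_simps)
  qed
  obtain w where w: "w \<in> exps A" "restrict_exp A m + w \<in> socle_exps N A"
    using socle_exp_above[OF _ A(1) bound] exp_on_in_exps[of A A] by blast
  moreover have "deg_in A m \<le> deg_in A (restrict_exp A m + w)" by simp
  ultimately show thesis using that by blast
qed

section \<open>Separation of degrees\<close>

text \<open>
  The exponents of the saturation with respect to the maximal ideal of \<open>K[A]\<close>, whose \<open>k\<close>-th power is
  spanned by the exponents of degree at least \<open>k\<close>.  For \<open>A = \<emptyset>\<close> and \<open>k > 0\<close> there are none of
  these, so the saturation is everything.
\<close>

definition sat_exps :: "('x \<Rightarrow>\<^sub>0 nat) set \<Rightarrow> 'x set \<Rightarrow> ('x \<Rightarrow>\<^sub>0 nat) set"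
  where "sat_exps M A = {m \<in> exps A. \<exists>k. \<forall>w\<in>exps A. k \<le> deg_in A w \<longrightarrow> m + w \<in> M}"

text \<open>
  A socle element lies in the saturation but not in \<open>I(\<pp>)\<close>, so a cut-off degree \<open>a\<close> has to separate
  its degree from those occurring in \<open>I(\<pp>)\<close>.  Conversely \<open>a = max deg Soc + 1\<close> is a cut-off degree,
  because an element of the saturation outside \<open>I(\<pp>)\<close> has a multiple in the socle.
\<close>

lemma local_exps_eq_sat_cut_iff:
  fixes N :: "('x::finite \<Rightarrow>\<^sub>0 nat) set"
  assumes up: "upset UNIV N" and ne: "socle_exps N A \<noteq> {}"
  shows "(\<exists>a>0. local_exps N A = sat_exps (local_exps N A) A \<inter> {m \<in> exps A. a \<le> deg_in A m}) \<longleftrightarrow>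
    (\<forall>m\<in>local_exps N A. \<forall>s\<in>socle_exps N A. deg_in A s < deg_in A m)"
    (is "(\<exists>a>0. ?M = ?S \<inter> ?D a) \<longleftrightarrow> ?R")
proof
  assume "\<exists>a>0. ?M = ?S \<inter> ?D a"
  then obtain a where a: "?M = ?S \<inter> ?D a" by blast
  show ?R
  proof (intro ballI)
    fix m s assume m: "m \<in> ?M" and s: "s \<in> socle_exps N A"
    have "s \<in> ?S"
      unfolding sat_exps_def
    proof (intro CollectI conjI exI[of _ 1] ballI impI)
      show "s \<in> exps A" using s by (simp add: socle_exps_def)
      fix w assume w: "w \<in> exps A" "1 \<le> deg_in A w"
      then obtain i w' where i: "i \<in> A" "w = w' + unit_exp i"
        using exp_splits_off_unit[of A w] by auto
      have "s + unit_exp i + w' \<in> ?M"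
        using upsetD[OF upset_local_exps[OF up]] s i w by (simp add: socle_exps_def)
      then show "s + w \<in> ?M" using i by (simp add: ac_simps)
    qed
    moreover have "s \<in> exps A" "s \<notin> ?M" using s by (simp_all add: socle_exps_def)
    ultimately have "s \<notin> ?D a" using a by blast
    then have "deg_in A s < a" using \<open>s \<in> exps A\<close> by simp
    also have "a \<le> deg_in A m" using m a by blast
    finally show "deg_in A s < deg_in A m" .
  qed
next
  assume R: ?R
  define a where "a = Suc (Max (deg_in A ` socle_exps N A))"
  have fin: "finite (deg_in A ` socle_exps N A)" using finite_socle_exps[OF up] by simp
  have a: "deg_in A s < a" if "s \<in> socle_exps N A" for s
    using that fin by (auto simp: a_def less_Suc_eq_le)
  have "Max (deg_in A ` socle_exps N A) \<in> deg_in A ` socle_exps N A"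
    using fin ne by (intro Max_in) auto
  then obtain s where s: "s \<in> socle_exps N A" "a = Suc (deg_in A s)" by (auto simp: a_def)
  have "?M = ?S \<inter> ?D a"
  proof (intro equalityI subsetI IntI)
    fix m assume m: "m \<in> ?M"
    have "deg_in A s < deg_in A m" using R m s(1) by blast
    then show "m \<in> ?D a" using m s(2) by (simp add: local_exps_def)
    show "m \<in> ?S" using m upset_local_exps[OF up, of A] unfolding sat_exps_def upset_def by blast
  next
    fix m assume m: "m \<in> ?S \<inter> ?D a"
    then obtain k where mA: "m \<in> exps A"
        and k: "\<And>w. w \<in> exps A \<Longrightarrow> k \<le> deg_in A w \<Longrightarrow> m + w \<in> ?M"
      unfolding sat_exps_def by blast
    show "m \<in> ?M"
    proof (rule ccontr)
      assume "m \<notin> ?M"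
      moreover have "deg_in A w \<le> k" if "w \<in> exps A" "m + w \<notin> ?M" for w
        using k[OF that(1)] that(2) by linarith
      ultimately obtain w where "w \<in> exps A" "m + w \<in> socle_exps N A"
        using socle_exp_above[OF mA] by blast
      then show False using a[of "m + w"] m by simp
    qed
  qed
  then show "\<exists>a>0. ?M = ?S \<inter> ?D a" by (intro exI[of _ a]) (simp add: a_def)
qed

section \<open>Intersections of degree conditions\<close>

text \<open>
  Conditions that involve a variable outside \<open>A\<close> disappear in the localization, because a
  sufficiently large multiplier off \<open>A\<close> satisfies them all.
\<close>

lemma local_exps_presentation:
  fixes N :: "('x::finite \<Rightarrow>\<^sub>0 nat) set"
  assumes N: "N = {m. \<forall>j\<in>J. d j \<le> deg_in (B j) m}" and "finite J"
  shows "local_exps N A = {m \<in> exps A. \<forall>j\<in>J. B j \<subseteq> A \<longrightarrow> d j \<le> deg_in (B j) m}"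
proof (intro equalityI subsetI)
  fix m assume "m \<in> local_exps N A"
  then obtain v where mA: "m \<in> exps A" and v: "v \<in> exps (- A)" "m + v \<in> N"
    by (auto simp: local_exps_def)
  have "deg_in (B j) v = 0" if "B j \<subseteq> A" for j
    using that v(1) by (auto simp: deg_in_eq_0 exps_iff)
  then show "m \<in> {m \<in> exps A. \<forall>j\<in>J. B j \<subseteq> A \<longrightarrow> d j \<le> deg_in (B j) m}"
    using mA v(2) unfolding N by fastforce
next
  fix m assume m: "m \<in> {m \<in> exps A. \<forall>j\<in>J. B j \<subseteq> A \<longrightarrow> d j \<le> deg_in (B j) m}"
  define v where "v = exp_on (- A) (\<lambda>_. \<Sum>j\<in>J. d j)"
  have "d j \<le> deg_in (B j) (m + v)" if j: "j \<in> J" for j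
  proof (cases "B j \<subseteq> A")
    case True then show ?thesis using m j by fastforce
  next
    case False
    then obtain i where i: "i \<in> B j" "i \<notin> A" by blast
    have "d j \<le> (\<Sum>j\<in>J. d j)" using j \<open>finite J\<close> by (intro member_le_sum) auto
    also have "\<dots> = Poly_Mapping.lookup v i" using i by (simp add: v_def)
    also have "\<dots> \<le> deg_in (B j) v" using i by (intro lookup_le_deg_in)
    finally show ?thesis by simp
  qed
  then have "m + v \<in> N" by (simp add: N)
  moreover have "v \<in> exps (- A)" unfolding v_def by (rule exp_on_in_exps) simp
  ultimately show "m \<in> local_exps N A" using m by (auto simp: local_exps_def)
qed

text \<open>
  The socle element violates a condition with \<open>B j \<subseteq> A\<close>.  A variable in \<open>A\<close> but not in \<open>B j\<close> would
  not change the degree in \<open>B j\<close>, and so could not take it into the localized ideal.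
\<close>

lemma socle_exp_presentation:
  fixes N :: "('x::finite \<Rightarrow>\<^sub>0 nat) set"
  assumes N: "N = {m. \<forall>j\<in>J. d j \<le> deg_in (B j) m}" and "finite J"
    and s: "s \<in> socle_exps N A"
  obtains j where "j \<in> J" "B j = A" "deg_in A s < d j"
proof -
  note L = local_exps_presentation[OF N \<open>finite J\<close>, of A]
  obtain j where j: "j \<in> J" "B j \<subseteq> A" "deg_in (B j) s < d j"
    using s by (auto simp: socle_exps_def L not_le)
  have "i \<in> B j" if i: "i \<in> A" for i
  proof (rule ccontr)
    assume "i \<notin> B j"
    have "d j \<le> deg_in (B j) (s + unit_exp i)"
      using s i j by (auto simp: socle_exps_def L)
    with \<open>i \<notin> B j\<close> j show False by simp
  qed
  then have "B j = A" using j by blast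
  with j that show thesis by blast
qed

lemma presentation_imp_degrees_separated:
  fixes N :: "('x::finite \<Rightarrow>\<^sub>0 nat) set"
  assumes N: "N = {m. \<forall>j\<in>J. d j \<le> deg_in (B j) m}" and "finite J"
    and s: "s \<in> socle_exps N A" and m: "m \<in> local_exps N A"
  shows "deg_in A s < deg_in A m"
proof -
  obtain j where "j \<in> J" "B j = A" "deg_in A s < d j"
    using socle_exp_presentation[OF N \<open>finite J\<close> s] .
  moreover have "d j \<le> deg_in A m"
    using m calculation by (auto simp: local_exps_presentation[OF N \<open>finite J\<close>])
  ultimately show ?thesis by simp
qed

text \<open>
  Separation says that elements of \<open>N\<close> satisfy the displayed conditions; an element outside \<open>N\<close>
  violates one of them because a socle element lies above one of its parts.
\<close>

lemma degrees_separated_imp_presentation: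
  fixes N :: "('x::finite \<Rightarrow>\<^sub>0 nat) set"
  assumes up: "upset UNIV N"
    and sep: "\<And>A m s. m \<in> local_exps N A \<Longrightarrow> s \<in> socle_exps N A \<Longrightarrow> deg_in A s < deg_in A m"
  shows "N = {m. \<forall>A\<in>{A. socle_exps N A \<noteq> {}}. Suc (Max (deg_in A ` socle_exps N A)) \<le> deg_in A m}"
    (is "N = ?R")
proof (intro equalityI subsetI)
  fix m assume m: "m \<in> N"
  have "Suc (Max (deg_in A ` socle_exps N A)) \<le> deg_in A m" if ne: "socle_exps N A \<noteq> {}" for A
  proof -
    have "deg_in A s < deg_in A m" if "s \<in> socle_exps N A" for s
      using sep[OF restrict_exp_in_local_exps[OF m] that] by simp
    then show ?thesis using ne finite_socle_exps[OF up] by (simp add: Suc_le_eq)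
  qed
  then show "m \<in> ?R" by simp
next
  fix m assume m: "m \<in> ?R"
  show "m \<in> N"
  proof (rule ccontr)
    assume "m \<notin> N"
    then obtain A s where s: "s \<in> socle_exps N A" "deg_in A m \<le> deg_in A s"
      using not_mem_imp_socle_exp[OF up] by blast
    have "deg_in A s \<le> Max (deg_in A ` socle_exps N A)"
      using s finite_socle_exps[OF up] by (intro Max_ge) auto
    moreover have "Suc (Max (deg_in A ` socle_exps N A)) \<le> deg_in A m" using m s by auto
    ultimately show False using s by simp
  qed
qed

text \<open>
  Irredundancy gives an \<open>m\<close> that violates the \<open>j\<close>-th condition only.  Multiplying its part in \<open>B j\<close> by
  a power of one variable of \<open>B j\<close> raises the degree to \<open>d j - 1\<close>, one step before the condition
  holds, and the result is a socle element.  If \<open>B j = \<emptyset>\<close>, the condition cannot be satisfied at all,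
  so \<open>N = \<emptyset>\<close>, and \<open>d j\<close> can be any positive number.
\<close>

lemma irredundant_socle_exp:
  fixes N :: "('x::finite \<Rightarrow>\<^sub>0 nat) set"
  assumes N: "N = {m. \<forall>j\<in>J. d j \<le> deg_in (B j) m}" and "finite J"
    and j: "j \<in> J" and irr: "N \<noteq> {m. \<forall>l\<in>J - {j}. d l \<le> deg_in (B l) m}"
  shows "socle_exps N (B j) \<noteq> {}"
    and "N \<noteq> {} \<Longrightarrow> Max (deg_in (B j) ` socle_exps N (B j)) + 1 = d j"
proof -
  define A where "A = B j"
  note L = local_exps_presentation[OF N \<open>finite J\<close>, of A]
  obtain m where m: "\<And>l. l \<in> J \<Longrightarrow> l \<noteq> j \<Longrightarrow> d l \<le> deg_in (B l) m" and "m \<notin> N"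
    using irr unfolding N by blast
  then have mj: "deg_in A m < d j" unfolding N A_def using not_le by blast
  define t where "t = d j - 1 - deg_in A m"
  define s where "s = (if A = {} then 0 else
    restrict_exp A m + exp_on {SOME i. i \<in> A} (\<lambda>_. t))"
  have sA: "s \<in> exps A"
    unfolding s_def using some_in_eq[of A] by (simp add: exp_on_in_exps)
  have sm: "deg_in (B l) m \<le> deg_in (B l) s" if "B l \<subseteq> A" for l
    using that by (auto simp: s_def deg_in_def[of "{}"])
  have degs: "deg_in A s = (if A = {} then 0 else d j - 1)"
  proof (cases "A = {}")
    case False
    then have "(SOME i. i \<in> A) \<in> A" by (simp add: some_in_eq)
    then have "deg_in A (exp_on {SOME i. i \<in> A} (\<lambda>_. t)) = t"
      by (simp add: deg_in_def)
    then show ?thesis using False mj by (simp add: s_def t_def)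
  qed (simp add: s_def)
  have "s + unit_exp i \<in> local_exps N A" if i: "i \<in> A" for i
    unfolding L
  proof (intro CollectI conjI ballI impI)
    show "s + unit_exp i \<in> exps A" using sA i by simp
    fix l assume l: "l \<in> J" "B l \<subseteq> A"
    show "d l \<le> deg_in (B l) (s + unit_exp i)"
    proof (cases "l = j")
      case True then show ?thesis using i degs mj unfolding A_def by auto
    next
      case False then show ?thesis using m[OF l(1)] sm[OF l(2)] by simp
    qed
  qed
  moreover have "s \<notin> local_exps N A"
  proof
    assume "s \<in> local_exps N A"
    then have "d j \<le> deg_in A s" unfolding L using j A_def by simp
    then show False using degs mj by (simp split: if_splits)
  qed
  ultimately have s: "s \<in> socle_exps N A" using sA by (auto simp: socle_exps_def)
  then show "socle_exps N (B j) \<noteq> {}" by (auto simp: A_def)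
  assume "N \<noteq> {}"
  then obtain u where "u \<in> N" by blast
  then have "d j \<le> deg_in A u" unfolding N A_def using j by blast
  then have "A \<noteq> {}" using mj by (auto simp: deg_in_def)
  have "deg_in A u \<le> d j - 1" if u: "u \<in> socle_exps N A" for u
  proof -
    \<comment> \<open>If \<open>l \<noteq> j\<close>, the exponent \<open>m\<close> satisfies condition \<open>l\<close>, so \<open>d l \<le> deg_in A m < d j\<close>.\<close>
    obtain l where l: "l \<in> J" "B l = A" "deg_in A u < d l"
      using socle_exp_presentation[OF N \<open>finite J\<close> u] .
    show ?thesis using m[OF l(1)] l mj by (cases "l = j") auto
  qed
  then have "Max (deg_in A ` socle_exps N A) = d j - 1"
    using s degs \<open>A \<noteq> {}\<close> by (intro Max_eqI) (auto intro!: finite_subset[of _ "{..d j - 1}"] intro: rev_image_eqI)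
  then show "Max (deg_in (B j) ` socle_exps N (B j)) + 1 = d j"
    using mj by (simp add: A_def)
qed

section \<open>Spans of monomials\<close>

definition poly_span :: "('x \<Rightarrow>\<^sub>0 nat) set \<Rightarrow> ('x, 'k::zero) mpoly set"
  where "poly_span M = {f. Poly_Mapping.keys f \<subseteq> M}"

lemma polyring_simps [simp]:
  "carrier (polyring A) = poly_span (exps A)"
  "mult (polyring A) = (*)" "one (polyring A) = 1" "zero (polyring A) = 0" "add (polyring A) = (+)"
  by (auto simp: polyring_def poly_span_def exps_def)

lemma poly_span_UNIV [simp]: "poly_span UNIV = UNIV"
  by (simp add: poly_span_def)

lemma zero_in_poly_span [simp]: "0 \<in> poly_span M"
  by (simp add: poly_span_def)

lemma single_in_poly_span [simp]:
  "Poly_Mapping.single m c \<in> poly_span M \<longleftrightarrow> c = 0 \<or> m \<in> M"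
  by (auto simp: poly_span_def)

lemma add_in_poly_span: "f \<in> poly_span M \<Longrightarrow> g \<in> poly_span M \<Longrightarrow> f + g \<in> poly_span M"
  using Poly_Mapping.keys_add[of f g] by (auto simp: poly_span_def)

lemma uminus_in_poly_span:
  fixes f :: "('x, 'k::ring_1) mpoly"
  shows "f \<in> poly_span M \<Longrightarrow> - f \<in> poly_span M"
  by (simp add: poly_span_def in_keys_iff subset_iff)

lemma poly_span_subset_iff:
  "(poly_span M :: ('x, 'k::zero_neq_one) mpoly set) \<subseteq> poly_span Q \<longleftrightarrow> M \<subseteq> Q"
proof
  assume sub: "(poly_span M :: ('x, 'k) mpoly set) \<subseteq> poly_span Q"
  show "M \<subseteq> Q"
  proof
    fix m assume "m \<in> M"
    then have "Poly_Mapping.single m (1 :: 'k) \<in> poly_span M" by simp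
    then have "Poly_Mapping.single m (1 :: 'k) \<in> poly_span Q" using sub by blast
    then show "m \<in> Q" by simp
  qed
qed (auto simp: poly_span_def)

lemma poly_span_eq_iff:
  "(poly_span M :: ('x, 'k::zero_neq_one) mpoly set) = poly_span Q \<longleftrightarrow> M = Q"
  using poly_span_subset_iff[where 'k = 'k] by (metis subset_antisym subset_refl)

lemma poly_span_Int: "poly_span M \<inter> poly_span Q = poly_span (M \<inter> Q)"
  by (auto simp: poly_span_def)

lemma poly_span_INT: "(\<Inter>j\<in>J. poly_span (M j)) = poly_span (\<Inter>j\<in>J. M j)"
  by (auto simp: poly_span_def)

lemma poly_eq_sum_single:
  fixes f :: "('x, 'k::comm_ring_1) mpoly"
  shows
  "f = (\<Sum>m\<in>Poly_Mapping.keys f. Poly_Mapping.single m (Poly_Mapping.lookup f m))"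
  by (rule poly_mapping_eqI)
    (auto simp: lookup_sum lookup_single when_def in_keys_iff sum.delta)

lemma poly_span_induct [consumes 1, case_names zero add single]:
  fixes f :: "('x, 'k::comm_ring_1) mpoly"
  assumes f: "f \<in> poly_span M"
    and zero: "P 0" and add: "\<And>g h. P g \<Longrightarrow> P h \<Longrightarrow> P (g + h)"
    and single: "\<And>m c. m \<in> M \<Longrightarrow> P (Poly_Mapping.single m c)"
  shows "P f"
proof -
  have "P (\<Sum>m\<in>K. Poly_Mapping.single m (Poly_Mapping.lookup f m))"
    if "K \<subseteq> M" "finite K" for K
    using that(2,1) by (induction K rule: finite_induct) (auto intro: zero add single)
  then have "P (\<Sum>m\<in>Poly_Mapping.keys f. Poly_Mapping.single m (Poly_Mapping.lookup f m))"
    using f by (simp add: poly_span_def)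
  then show ?thesis by (simp flip: poly_eq_sum_single)
qed

lemma mult_in_poly_span:
  assumes "f \<in> poly_span M" "g \<in> poly_span Q" "\<And>m q. m \<in> M \<Longrightarrow> q \<in> Q \<Longrightarrow> m + q \<in> L"
  shows "f * g \<in> poly_span L"
  using assms Poly_Mapping.keys_mult[of f g] unfolding poly_span_def by blast

section \<open>Sums of exponents that arise in only one way\<close>

text \<open>
  Maximize one coordinate after the other, in both sets.  A sum of two elements that are maximal in
  coordinate \<open>i\<close> can only be written as a sum of two such elements, so each pass keeps the pair of
  subsets a face: sums from it have all their summands in it.  After all coordinates one element is
  left on each side.  (Leading monomials would serve the same purpose, given an order on the
  variables.)
\<close>

lemma unique_sum_pair:
  fixes F G :: "('x::finite \<Rightarrow>\<^sub>0 nat) set"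
  assumes "finite F" "finite G" "F \<noteq> {}" "G \<noteq> {}"
  obtains a b where "a \<in> F" "b \<in> G"
    "\<And>a' b'. a' \<in> F \<Longrightarrow> b' \<in> G \<Longrightarrow> a' + b' = a + b \<Longrightarrow> a' = a \<and> b' = b"
proof -
  let ?l = "Poly_Mapping.lookup"
  define const_on :: "'x set \<Rightarrow> ('x \<Rightarrow>\<^sub>0 nat) set \<Rightarrow> bool"
    where "const_on B X \<longleftrightarrow> (\<forall>i\<in>B. \<forall>a\<in>X. \<forall>a'\<in>X. ?l a i = ?l a' i)" for B X
  define face where "face F' G' \<longleftrightarrow>
    (\<forall>a\<in>F'. \<forall>b\<in>G'. \<forall>a'\<in>F. \<forall>b'\<in>G. a' + b' = a + b \<longrightarrow> a' \<in> F' \<and> b' \<in> G')" for F' G'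
  have "\<exists>F' G'. F' \<subseteq> F \<and> G' \<subseteq> G \<and> F' \<noteq> {} \<and> G' \<noteq> {} \<and> const_on B F' \<and> const_on B G' \<and> face F' G'"
    for B :: "'x set"
  proof (induction B rule: finite_induct[OF finite])
    case 1
    show ?case using assms by (intro exI[of _ F] exI[of _ G]) (auto simp: const_on_def face_def)
  next
    case (2 i B)
    then obtain F' G' where sub: "F' \<subseteq> F" "G' \<subseteq> G" and ne: "F' \<noteq> {}" "G' \<noteq> {}"
      and const: "const_on B F'" "const_on B G'" and face: "face F' G'"
      by blast
    have fin: "finite F'" "finite G'" using sub assms finite_subset by blast+
    define p q where "p = Max ((\<lambda>a. ?l a i) ` F')" and "q = Max ((\<lambda>b. ?l b i) ` G')"
    have p: "p \<in> (\<lambda>a. ?l a i) ` F'" and q: "q \<in> (\<lambda>b. ?l b i) ` G'"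
      unfolding p_def q_def using fin ne by (auto intro!: Max_in)
    have ple: "?l a i \<le> p" if "a \<in> F'" for a
      unfolding p_def using that fin by (intro Max_ge) auto
    have qle: "?l b i \<le> q" if "b \<in> G'" for b
      unfolding q_def using that fin by (intro Max_ge) auto
    let ?F = "{a \<in> F'. ?l a i = p}" and ?G = "{b \<in> G'. ?l b i = q}"
    have "face ?F ?G"
      unfolding face_def
    proof (intro ballI impI)
      fix a b a' b'
      assume ab: "a \<in> ?F" "b \<in> ?G" and in_FG: "a' \<in> F" "b' \<in> G" and eq: "a' + b' = a + b"
      have in': "a' \<in> F'" "b' \<in> G'" using face ab in_FG eq unfolding face_def by blast+
      have "?l a' i + ?l b' i = p + q"
        using arg_cong[OF eq, of "\<lambda>m. ?l m i"] ab by (simp add: lookup_add)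
      then have "?l a' i = p" "?l b' i = q" using ple[OF in'(1)] qle[OF in'(2)] by linarith+
      then show "a' \<in> ?F \<and> b' \<in> ?G" using in' by blast
    qed
    moreover have "const_on (insert i B) ?F" "const_on (insert i B) ?G"
      using const by (auto simp: const_on_def)
    moreover have "?F \<noteq> {}" "?G \<noteq> {}" using p q by auto
    moreover have "?F \<subseteq> F" "?G \<subseteq> G" using sub by auto
    ultimately show ?case by blast
  qed
  from this[of UNIV] obtain F' G' where sub: "F' \<subseteq> F" "G' \<subseteq> G" and ne: "F' \<noteq> {}" "G' \<noteq> {}"
    and const: "const_on UNIV F'" "const_on UNIV G'" and face: "face F' G'"
    by blast
  obtain a b where ab: "a \<in> F'" "b \<in> G'" using ne by blast
  have "a' = a \<and> b' = b" if "a' \<in> F" "b' \<in> G" "a' + b' = a + b" for a' b'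
  proof -
    have "a' \<in> F'" "b' \<in> G'" using face ab that unfolding face_def by blast+
    then have "?l a' i = ?l a i" "?l b' i = ?l b i" for i
      using const ab unfolding const_on_def by blast+
    then show ?thesis by (simp add: poly_mapping_eqI)
  qed
  then show thesis using that ab sub by blast
qed

text \<open>No other pair of terms contributes to the coefficient at \<open>a + b\<close>, so nothing can cancel it.\<close>

lemma lookup_mult_unique:
  fixes f g :: "('x, 'k::comm_ring_1) mpoly"
  assumes unique: "\<And>a' b'. a' \<in> Poly_Mapping.keys f \<Longrightarrow> b' \<in> Poly_Mapping.keys g \<Longrightarrow>
      a' + b' = a + b \<Longrightarrow> a' = a \<and> b' = b"
  shows "Poly_Mapping.lookup (f * g) (a + b) = Poly_Mapping.lookup f a * Poly_Mapping.lookup g b"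
proof -
  let ?f = "Poly_Mapping.lookup f" and ?g = "Poly_Mapping.lookup g"
  have "f * g = (\<Sum>a'\<in>Poly_Mapping.keys f. \<Sum>b'\<in>Poly_Mapping.keys g.
      Poly_Mapping.single (a' + b') (?f a' * ?g b'))"
    by (subst (1) poly_eq_sum_single[of f], subst (1) poly_eq_sum_single[of g])
      (simp add: sum_product mult_single)
  then have "Poly_Mapping.lookup (f * g) (a + b) =
      (\<Sum>a'\<in>Poly_Mapping.keys f. \<Sum>b'\<in>Poly_Mapping.keys g. ?f a' * ?g b' when a' + b' = a + b)"
    by (simp add: lookup_sum lookup_single)
  also have "\<dots> = (\<Sum>a'\<in>Poly_Mapping.keys f. \<Sum>b'\<in>Poly_Mapping.keys g.
      if b' = b then if a' = a then ?f a * ?g b else 0 else 0)"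
    using unique by (intro sum.cong refl) (auto simp: when_def)
  also have "\<dots> = ?f a * ?g b"
    by (cases "b \<in> Poly_Mapping.keys g") (auto simp: sum.delta in_keys_iff)
  finally show ?thesis .
qed

lemma lookup_mult_single_shift:
  fixes f :: "('x, 'k::comm_ring_1) mpoly"
  shows "Poly_Mapping.lookup (f * Poly_Mapping.single u 1) (m + u) = Poly_Mapping.lookup f m"
  using lookup_mult_unique[of f "Poly_Mapping.single u 1" m u] by (auto split: if_splits)

lemma mult_single_in_poly_span_iff:
  fixes f :: "('x, 'k::comm_ring_1) mpoly"
  shows "f * Poly_Mapping.single u 1 \<in> poly_span M \<longleftrightarrow> (\<forall>m\<in>Poly_Mapping.keys f. m + u \<in> M)"
proof
  assume *: "f * Poly_Mapping.single u 1 \<in> poly_span M"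
  show "\<forall>m\<in>Poly_Mapping.keys f. m + u \<in> M"
  proof
    fix m assume "m \<in> Poly_Mapping.keys f"
    then have "m + u \<in> Poly_Mapping.keys (f * Poly_Mapping.single u 1)"
      by (simp add: in_keys_iff lookup_mult_single_shift)
    with * show "m + u \<in> M" by (auto simp: poly_span_def)
  qed
next
  assume "\<forall>m\<in>Poly_Mapping.keys f. m + u \<in> M"
  then show "f * Poly_Mapping.single u 1 \<in> poly_span M"
    by (intro mult_in_poly_span[of f "Poly_Mapping.keys f" _ "{u}"])
      (auto simp: poly_span_def)
qed

section \<open>Ideals spanned by monomials\<close>

lemma ideal_poly_span:
  assumes "upset A M"
  shows "ideal (poly_span M :: ('x, 'k::comm_ring_1) mpoly set) (polyring A)"
proof -
  interpret cring "polyring A :: ('x, 'k) mpoly ring" by (rule cring_polyring)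
  have sub: "(poly_span M :: ('x, 'k) mpoly set) \<subseteq> poly_span (exps A)"
    using assms by (auto simp: poly_span_def upset_def)
  have "\<ominus>\<^bsub>polyring A\<^esub> f \<in> poly_span M" if "f \<in> poly_span M" for f :: "('x, 'k) mpoly"
  proof -
    have "\<ominus>\<^bsub>polyring A\<^esub> f = - f"
      using that sub uminus_in_poly_span[OF that] by (intro minus_equality) auto
    then show ?thesis using uminus_in_poly_span[OF that] by simp
  qed
  then have "subgroup (poly_span M) (add_monoid (polyring A :: ('x, 'k) mpoly ring))"
    using sub by (intro add.subgroupI) (auto intro: add_in_poly_span zero_in_poly_span simp flip: a_inv_def)
  moreover have "f * g \<in> poly_span M"
    if "f \<in> poly_span M" "g \<in> poly_span (exps A)" for f g :: "('x, 'k) mpoly"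
    using that by (rule mult_in_poly_span) (rule upsetD[OF assms])
  ultimately show ?thesis
    by (intro idealI ring_axioms) (auto simp: mult.commute)
qed

lemma upset_generated:
  assumes "G \<subseteq> exps A"
  shows "upset A {g + w | g w. g \<in> G \<and> w \<in> exps A}"
  unfolding upset_def
proof (intro conjI ballI)
  fix m w' assume "m \<in> {g + w | g w. g \<in> G \<and> w \<in> exps A}" and w': "w' \<in> exps A"
  then obtain g w where "g \<in> G" "w \<in> exps A" "m = g + w" by blast
  with w' have "m + w' = g + (w + w')" "w + w' \<in> exps A" by (simp_all add: add.assoc)
  with \<open>g \<in> G\<close> show "m + w' \<in> {g + w | g w. g \<in> G \<and> w \<in> exps A}" by blast
qed (use assms in auto)

lemma genideal_monomials:
  assumes "G \<subseteq> exps A"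
  shows "Idl\<^bsub>polyring A\<^esub> ((\<lambda>m. Poly_Mapping.single m 1) ` G) =
    (poly_span {g + w | g w. g \<in> G \<and> w \<in> exps A} :: ('x, 'k::comm_ring_1) mpoly set)"
    (is "Idl\<^bsub>?R\<^esub> ?X = poly_span ?M")
proof
  interpret cring ?R by (rule cring_polyring)
  have "upset A ?M"
    by (rule upset_generated[OF assms])
  then have "ideal (poly_span ?M) ?R" by (rule ideal_poly_span)
  moreover have "g \<in> ?M" if "g \<in> G" for g
    using that zero_in_exps by (metis (mono_tags, lifting) add.right_neutral mem_Collect_eq)
  ultimately show "Idl\<^bsub>?R\<^esub> ?X \<subseteq> poly_span ?M"
    by (intro genideal_minimal) auto
  have X: "?X \<subseteq> carrier ?R" using assms by auto
  then interpret J: ideal "Idl\<^bsub>?R\<^esub> ?X" ?R by (rule genideal_ideal)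
  show "poly_span ?M \<subseteq> Idl\<^bsub>?R\<^esub> ?X"
  proof
    fix f :: "('x, 'k) mpoly" assume "f \<in> poly_span ?M"
    then show "f \<in> Idl\<^bsub>?R\<^esub> ?X"
    proof (induction rule: poly_span_induct)
      case zero show ?case using J.zero_closed by simp
    next
      case (add g h) then show ?case using J.a_closed by simp
    next
      case (single m c)
      then obtain g w where gw: "m = g + w" "g \<in> G" "w \<in> exps A" by blast
      have "Poly_Mapping.single g 1 \<in> Idl\<^bsub>?R\<^esub> ?X"
        using genideal_self[OF X] gw(2) by blast
      from J.I_l_closed[OF this, of "Poly_Mapping.single w c"] gw
      show ?case by (simp add: mult_single ac_simps)
    qed
  qed
qed

lemma var_eq_single_unit_exp: "var i = Poly_Mapping.single (unit_exp i) 1"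
  by (simp add: var_def unit_exp_def)

lemma genideal_vars:
  fixes A :: "'x::finite set"
  assumes "B \<subseteq> A"
  shows "Idl\<^bsub>polyring A\<^esub> (var ` B) =
    (poly_span {m \<in> exps A. 1 \<le> deg_in B m} :: ('x, 'k::comm_ring_1) mpoly set)"
proof -
  have "var ` B = (\<lambda>m. Poly_Mapping.single m (1 :: 'k)) ` unit_exp ` B"
    by (simp add: image_image var_eq_single_unit_exp)
  moreover have "{g + w | g w. g \<in> unit_exp ` B \<and> w \<in> exps A} = {m \<in> exps A. 1 \<le> deg_in B m}"
  proof (intro equalityI subsetI)
    fix m assume m: "m \<in> {m \<in> exps A. 1 \<le> deg_in B m}"
    then obtain i w where "i \<in> B" "m = w + unit_exp i"
      using exp_splits_off_unit[of B m] by auto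
    then show "m \<in> {g + w | g w. g \<in> unit_exp ` B \<and> w \<in> exps A}"
      using m by (intro CollectI exI[of _ "unit_exp i"] exI[of _ w]) (auto simp: add.commute)
  qed (use assms in auto)
  ultimately show ?thesis
    using genideal_monomials[of "unit_exp ` B" A, where 'k = 'k] assms
    by (simp add: image_subset_iff subsetD)
qed

lemma ideal_prod_poly_span:
  assumes M: "upset A M" and Q: "upset A Q"
  shows "ideal_prod (polyring A) (poly_span M) (poly_span Q) =
    (poly_span {m + q | m q. m \<in> M \<and> q \<in> Q} :: ('x, 'k::comm_ring_1) mpoly set)"
    (is "?P = poly_span ?S")
proof (intro equalityI subsetI)
  fix f assume "f \<in> ?P"
  then show "f \<in> poly_span ?S"
  proof (induction rule: ideal_prod.induct)
    case (prod i j)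
    then show ?case by (auto intro: mult_in_poly_span)
  next
    case (sum s1 s2)
    then show ?case by (simp add: add_in_poly_span)
  qed
next
  fix f :: "('x, 'k) mpoly" assume "f \<in> poly_span ?S"
  then show "f \<in> ?P"
  proof (induction rule: poly_span_induct)
    case zero
    show ?case using ideal_prod.prod[of 0 "poly_span M" 0 "poly_span Q" "polyring A"] by simp
  next
    case (add g h)
    then show ?case using ideal_prod.sum[of g "polyring A" _ _ h] by simp
  next
    case (single m c)
    then obtain a b where ab: "m = a + b" "a \<in> M" "b \<in> Q" by blast
    show ?case
      using ideal_prod.prod[of "Poly_Mapping.single a c" "poly_span M" "Poly_Mapping.single b 1"
          "poly_span Q" "polyring A"] ab
      by (simp add: mult_single)
  qed
qed

lemma ideal_power_vars:
  fixes A :: "'x::finite set"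
  assumes "B \<subseteq> A"
  shows "ideal_power (polyring A) (poly_span {m \<in> exps A. 1 \<le> deg_in B m}) k =
    (poly_span {m \<in> exps A. k \<le> deg_in B m} :: ('x, 'k::comm_ring_1) mpoly set)"
proof (induction k)
  case 0
  show ?case by (simp add: nat_pow_def ideals_set_def)
next
  case (Suc k)
  have "{m + q | m q. m \<in> {m \<in> exps A. k \<le> deg_in B m} \<and> q \<in> {m \<in> exps A. 1 \<le> deg_in B m}} =
      {m \<in> exps A. Suc k \<le> deg_in B m}" (is "?L = ?R")
  proof (intro equalityI subsetI)
    fix m assume m: "m \<in> ?R"
    then have "deg_in B m > 0" by auto
    then obtain i w where "i \<in> B" "m = w + unit_exp i"
      by (rule exp_splits_off_unit)
    then show "m \<in> ?L"
      using m assms by (intro CollectI exI[of _ w] exI[of _ "unit_exp i"]) auto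
  qed auto
  then have "ideal_prod (polyring A) (poly_span {m \<in> exps A. k \<le> deg_in B m})
      (poly_span {m \<in> exps A. 1 \<le> deg_in B m}) =
    (poly_span {m \<in> exps A. Suc k \<le> deg_in B m} :: ('x, 'k) mpoly set)"
    by (simp only: ideal_prod_poly_span[OF upset_deg_ge upset_deg_ge])
  with Suc show ?case by (simp add: nat_pow_def ideals_set_def)
qed

text \<open>
  Multiplication by a single monomial moves the terms of \<open>f\<close> without merging them, so whether
  \<open>f x\<^sup>q\<close> lies in the span can be read off term by term.
\<close>

lemma ideal_colon_poly_span:
  "ideal_colon (polyring A) (poly_span M) (poly_span Q) =
    (poly_span {m \<in> exps A. \<forall>q\<in>Q. m + q \<in> M} :: ('x, 'k::comm_ring_1) mpoly set)"
proof (intro equalityI subsetI)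
  fix f :: "('x, 'k) mpoly"
  assume f: "f \<in> ideal_colon (polyring A) (poly_span M) (poly_span Q)"
  have "m + q \<in> M" if "m \<in> Poly_Mapping.keys f" "q \<in> Q" for m q
  proof -
    have "f * Poly_Mapping.single q 1 \<in> poly_span M"
      using f that by (simp add: ideal_colon_def)
    then show ?thesis using that by (simp add: mult_single_in_poly_span_iff)
  qed
  then show "f \<in> poly_span {m \<in> exps A. \<forall>q\<in>Q. m + q \<in> M}"
    using f by (auto simp: ideal_colon_def poly_span_def)
next
  fix f :: "('x, 'k) mpoly"
  assume f: "f \<in> poly_span {m \<in> exps A. \<forall>q\<in>Q. m + q \<in> M}"
  then have "f \<in> poly_span (exps A)" by (auto simp: poly_span_def)
  with f show "f \<in> ideal_colon (polyring A) (poly_span M) (poly_span Q)"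
    by (auto simp: ideal_colon_def intro: mult_in_poly_span)
qed

section \<open>Monomial prime ideals\<close>

definition var_ideal :: "'x set \<Rightarrow> ('x, 'k::zero) mpoly set"
  where "var_ideal A = poly_span {m. 1 \<le> deg_in A m}"

text \<open>
  If neither factor lies in the ideal, consider the terms of degree zero in \<open>A\<close> of both factors.  Among
  them there is a pair whose product arises only once, and it survives in the product.
\<close>

lemma primeideal_var_ideal:
  "primeideal (var_ideal A :: ('x::finite, 'k::field) mpoly set) (polyring UNIV)"
proof (rule primeidealI)
  show "ideal (var_ideal A :: ('x, 'k) mpoly set) (polyring UNIV)"
    unfolding var_ideal_def by (rule ideal_poly_span) (auto simp: upset_def)
  show "cring (polyring UNIV :: ('x, 'k) mpoly ring)" by (rule cring_polyring)
  have "(1 :: ('x, 'k) mpoly) \<notin> var_ideal A"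
    by (simp add: var_ideal_def poly_span_def)
  then show "carrier (polyring UNIV) \<noteq> (var_ideal A :: ('x, 'k) mpoly set)" by auto
next
  fix f g :: "('x, 'k) mpoly"
  assume "f \<otimes>\<^bsub>polyring UNIV\<^esub> g \<in> var_ideal A"
  then have fg: "deg_in A m > 0" if "m \<in> Poly_Mapping.keys (f * g)" for m
    using that by (auto simp: var_ideal_def poly_span_def)
  show "f \<in> var_ideal A \<or> g \<in> var_ideal A"
  proof (rule ccontr)
    define F G where "F = {m \<in> Poly_Mapping.keys f. deg_in A m = 0}"
      and "G = {m \<in> Poly_Mapping.keys g. deg_in A m = 0}"
    assume "\<not> (f \<in> var_ideal A \<or> g \<in> var_ideal A)"
    then have "F \<noteq> {}" "G \<noteq> {}" by (force simp: var_ideal_def poly_span_def F_def G_def)+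
    then obtain a b where ab: "a \<in> F" "b \<in> G"
      and unique: "\<And>a' b'. a' \<in> F \<Longrightarrow> b' \<in> G \<Longrightarrow> a' + b' = a + b \<Longrightarrow> a' = a \<and> b' = b"
      using unique_sum_pair[of F G] by (auto simp: F_def G_def)
    have "Poly_Mapping.lookup (f * g) (a + b) = Poly_Mapping.lookup f a * Poly_Mapping.lookup g b"
    proof (rule lookup_mult_unique)
      fix a' b' assume *: "a' \<in> Poly_Mapping.keys f" "b' \<in> Poly_Mapping.keys g" "a' + b' = a + b"
      have "deg_in A a' + deg_in A b' = 0"
        using arg_cong[OF *(3), of "deg_in A"] ab by (simp add: F_def G_def)
      then show "a' = a \<and> b' = b" using * unique[of a' b'] by (simp add: F_def G_def)
    qed
    then have "a + b \<in> Poly_Mapping.keys (f * g)"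
      using ab by (auto simp: F_def G_def in_keys_iff)
    then show False using fg[of "a + b"] ab by (simp add: F_def G_def)
  qed
qed

lemma genideal_vars_UNIV:
  "Idl\<^bsub>polyring UNIV\<^esub> (var ` A) = (var_ideal A :: ('x::finite, 'k::comm_ring_1) mpoly set)"
  by (simp add: genideal_vars var_ideal_def)

lemma monomial_prime_ideal_iff:
  "monomial_prime_ideal (P :: ('x::finite, 'k::field) mpoly set) \<longleftrightarrow> (\<exists>A. P = var_ideal A)"
  unfolding monomial_prime_ideal_def genideal_vars_UNIV using primeideal_var_ideal by auto

lemma ideal_power_var_ideal:
  "ideal_power (polyring UNIV) (var_ideal A) k =
    (poly_span {m. k \<le> deg_in A m} :: ('x::finite, 'k::comm_ring_1) mpoly set)"
  using ideal_power_vars[of A UNIV k] by (simp add: var_ideal_def)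

lemma vars_in_var_ideal [simp]:
  "vars_in (var_ideal A :: ('x::finite, 'k::comm_ring_1) mpoly set) = A"
  by (auto simp: vars_in_def var_ideal_def var_eq_single_unit_exp split: if_splits)

lemma monomial_ideal_eq_poly_span:
  assumes "monomial_ideal (I :: ('x, 'k::comm_ring_1) mpoly set)"
  obtains N where "upset UNIV N" "I = poly_span N"
proof -
  obtain G where G: "G \<subseteq> monomials" "I = Idl\<^bsub>polyring UNIV\<^esub> G"
    using assms by (auto simp: monomial_ideal_def)
  have "monomials = range (\<lambda>m. Poly_Mapping.single m (1 :: 'k))"
    by (auto simp: monomials_def)
  then obtain G' where G': "G = (\<lambda>m. Poly_Mapping.single m 1) ` G'"
    using G(1) by (metis subset_imageE)
  have "I = poly_span {g + w | g w. g \<in> G' \<and> w \<in> exps UNIV}"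
    unfolding G(2) G' by (rule genideal_monomials) simp
  moreover have "upset UNIV {g + w | g w. g \<in> G' \<and> w \<in> exps UNIV}"
    by (rule upset_generated) simp
  ultimately show thesis using that by blast
qed

section \<open>Associated primes of monomial ideals\<close>

lemma Ass_iff:
  assumes "cring R" "ideal I R"
  shows "P \<in> Ass R I \<longleftrightarrow>
    primeideal P R \<and> (\<exists>f\<in>carrier R. P = {s \<in> carrier R. s \<otimes>\<^bsub>R\<^esub> f \<in> I})"
proof -
  interpret cring R by fact
  interpret I: ideal I R by fact
  have coset: "I +>\<^bsub>R\<^esub> x = I \<longleftrightarrow> x \<in> I" if "x \<in> carrier R" for x
    using I.a_rcos_const[of x] I.a_rcos_self[OF that] by auto
  have ann: "{s \<in> carrier R. (I +>\<^bsub>R\<^esub> s) \<otimes>\<^bsub>R Quot I\<^esub> (I +>\<^bsub>R\<^esub> f) = \<zero>\<^bsub>R Quot I\<^esub>} =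
      {s \<in> carrier R. s \<otimes>\<^bsub>R\<^esub> f \<in> I}" if "f \<in> carrier R" for f
    using that by (simp add: FactRing_def I.rcoset_mult_add coset cong: conj_cong)
  have "carrier (R Quot I) = (\<lambda>f. I +>\<^bsub>R\<^esub> f) ` carrier R"
    by (auto simp: FactRing_simps)
  then show ?thesis by (simp add: Ass_def ann cong: bex_cong)
qed

text \<open>
  A monomial is a product of variables, and a prime contains one of the factors.  The conclusion is
  phrased as the criterion for lying in the ideal generated by the variables in \<open>P\<close>.
\<close>

lemma prime_contains_var_of_monomial:
  fixes P :: "('x::finite, 'k::field) mpoly set"
  assumes P: "primeideal P (polyring UNIV)" and m: "Poly_Mapping.single m 1 \<in> P"
  shows "0 < deg_in (vars_in P) m"
  using m
proof (induction "deg_in UNIV m" arbitrary: m)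
  interpret P: primeideal P "polyring UNIV" by fact
  case 0
  then have "m = 0" by (simp add: deg_in_eq_0 exps_def)
  with 0 have "P = carrier (polyring UNIV)" using P.one_imp_carrier by simp
  then show ?case using P.I_notcarr by simp
next
  interpret P: primeideal P "polyring UNIV" by fact
  case (Suc k)
  obtain i w where iw: "m = w + unit_exp i"
    using exp_splits_off_unit[of UNIV m] Suc.hyps(2) by (metis zero_less_Suc)
  have "Poly_Mapping.single m 1 = Poly_Mapping.single w 1 * (var i :: ('x, 'k) mpoly)"
    by (simp add: iw var_eq_single_unit_exp mult_single)
  then have "Poly_Mapping.single w 1 \<in> P \<or> var i \<in> P"
    using Suc.prems P.I_prime[of "Poly_Mapping.single w 1" "var i"] by simp
  then show ?case
  proof
    assume "Poly_Mapping.single w 1 \<in> P"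
    then show ?thesis using Suc.hyps(1)[of w] Suc.hyps(2) iw by simp
  qed (simp add: iw vars_in_def)
qed

lemma prime_eq_var_idealI:
  fixes P :: "('x::finite, 'k::field) mpoly set"
  assumes P: "primeideal P (polyring UNIV)"
    and mono: "\<And>g m. g \<in> P \<Longrightarrow> m \<in> Poly_Mapping.keys g \<Longrightarrow> Poly_Mapping.single m 1 \<in> P"
  shows "P = var_ideal (vars_in P)"
proof
  interpret P: primeideal P "polyring UNIV" by fact
  show "P \<subseteq> var_ideal (vars_in P)"
    using mono prime_contains_var_of_monomial[OF P] by (force simp: var_ideal_def poly_span_def)
  have "Idl\<^bsub>polyring UNIV\<^esub> (var ` vars_in P) \<subseteq> P"
    by (intro P.genideal_minimal P.is_ideal) (auto simp: vars_in_def)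
  then show "var_ideal (vars_in P) \<subseteq> P" by (simp add: genideal_vars_UNIV)
qed

text \<open>
  Induction on the number of terms of \<open>f\<close> outside \<open>I\<close>.  Among the elements of \<open>P\<close> in which the term \<open>m\<close>
  occurs, take \<open>h\<close> with as few terms as possible, and take terms \<open>v\<close> of \<open>h\<close> and \<open>u \<notin> N\<close> of \<open>f\<close> whose
  product arises only once; then \<open>v + u \<in> N\<close>.  The monomial \<open>v\<close> is not in \<open>P\<close>, since otherwise its
  term could be removed from \<open>h\<close>.  So \<open>P\<close>, being prime, is also the annihilator of \<open>f\<close> times \<open>v\<close>
  modulo \<open>I\<close>, and in this product the term coming from \<open>u\<close> has moved into \<open>I\<close>.
\<close>

lemma prime_annihilator_monomial:
  fixes f :: "('x::finite, 'k::field) mpoly"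
  assumes P: "primeideal P (polyring UNIV)" and up: "upset UNIV N"
    and Pf: "P = {s. s * f \<in> poly_span N}"
    and g: "g \<in> P" and m: "m \<in> Poly_Mapping.keys g"
  shows "Poly_Mapping.single m 1 \<in> P"
  using Pf
proof (induction "card (Poly_Mapping.keys f - N)" arbitrary: f rule: less_induct)
  case less
  interpret P: primeideal P "polyring UNIV" by fact
  show ?case
  proof (rule ccontr)
    let ?bad = "\<lambda>h. h \<in> P \<and> m \<in> Poly_Mapping.keys h"
    assume nm: "Poly_Mapping.single m 1 \<notin> P"
    obtain h where h: "?bad h"
        and min: "\<And>h'. ?bad h' \<Longrightarrow> card (Poly_Mapping.keys h) \<le> card (Poly_Mapping.keys h')"
      using ex_has_least_nat[of ?bad g "\<lambda>h. card (Poly_Mapping.keys h)"] g m by blast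
    have "Poly_Mapping.keys f - N \<noteq> {}"
    proof
      assume "Poly_Mapping.keys f - N = {}"
      then have "1 \<in> P" using less.prems by (simp add: poly_span_def)
      then show False using P.one_imp_carrier P.I_notcarr by simp
    qed
    moreover have "Poly_Mapping.keys h \<noteq> {}" using h by blast
    ultimately obtain v u where v: "v \<in> Poly_Mapping.keys h" and u: "u \<in> Poly_Mapping.keys f - N"
      and unique: "\<And>v' u'. v' \<in> Poly_Mapping.keys h \<Longrightarrow> u' \<in> Poly_Mapping.keys f - N \<Longrightarrow>
        v' + u' = v + u \<Longrightarrow> v' = v \<and> u' = u"
      using unique_sum_pair[of "Poly_Mapping.keys h" "Poly_Mapping.keys f - N"] by auto
    \<comment> \<open>Terms of \<open>f\<close> in \<open>I\<close> only contribute terms in \<open>I\<close>, so outside \<open>N\<close> the pair would be unique.\<close>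
    have vu: "v + u \<in> N"
    proof (rule ccontr)
      assume no: "v + u \<notin> N"
      have "Poly_Mapping.lookup (h * f) (v + u) = Poly_Mapping.lookup h v * Poly_Mapping.lookup f u"
      proof (rule lookup_mult_unique)
        fix v' u' assume *: "v' \<in> Poly_Mapping.keys h" "u' \<in> Poly_Mapping.keys f" "v' + u' = v + u"
        have "u' \<notin> N"
          using upsetD[OF up, of u' v'] no *(3) by (auto simp: add.commute)
        then show "v' = v \<and> u' = u" using unique * by blast
      qed
      then have "v + u \<in> Poly_Mapping.keys (h * f)" using v u by (auto simp: in_keys_iff)
      moreover have "h * f \<in> poly_span N" using h less.prems by simp
      ultimately show False using no by (auto simp: poly_span_def)
    qed
    have v_notin: "Poly_Mapping.single v 1 \<notin> P"
    proof
      assume vP: "Poly_Mapping.single v 1 \<in> P"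
      define h' where "h' = h + Poly_Mapping.single 0 (- Poly_Mapping.lookup h v) * Poly_Mapping.single v 1"
      have keys: "Poly_Mapping.keys h' = Poly_Mapping.keys h - {v}"
        by (auto simp: h'_def mult_single in_keys_iff lookup_add lookup_single when_def split: if_splits)
      have "Poly_Mapping.single 0 (- Poly_Mapping.lookup h v) * Poly_Mapping.single v 1 \<in> P"
        using P.I_l_closed[OF vP] by simp
      then have "h' \<in> P"
        using h additive_subgroup.a_closed[OF P.additive_subgroup_axioms, of h "Poly_Mapping.single 0 (- Poly_Mapping.lookup h v) * Poly_Mapping.single v 1"]
        by (simp add: h'_def)
      moreover have "m \<noteq> v" using nm vP by auto
      ultimately have "card (Poly_Mapping.keys h) \<le> card (Poly_Mapping.keys h')"
        using h keys by (intro min) auto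
      moreover have "card (Poly_Mapping.keys h - {v}) < card (Poly_Mapping.keys h)"
        using v by (intro card_Diff1_less) auto
      ultimately show False using keys by simp
    qed
    define f' where "f' = f * Poly_Mapping.single v 1"
    have "P = {s. s * f' \<in> poly_span N}"
    proof (intro equalityI subsetI)
      fix s assume "s \<in> P"
      then have "Poly_Mapping.single v 1 * s \<in> P" using P.I_l_closed[of s] by simp
      then show "s \<in> {s. s * f' \<in> poly_span N}" using less.prems by (simp add: f'_def ac_simps)
    next
      fix s assume "s \<in> {s. s * f' \<in> poly_span N}"
      then have "s * Poly_Mapping.single v 1 \<in> P" using less.prems by (simp add: f'_def ac_simps)
      then show "s \<in> P" using P.I_prime[of s "Poly_Mapping.single v 1"] v_notin by simp
    qed
    moreover have "card (Poly_Mapping.keys f' - N) < card (Poly_Mapping.keys f - N)"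
    proof -
      have "Poly_Mapping.keys f' - N \<subseteq> (\<lambda>u'. u' + v) ` (Poly_Mapping.keys f - N - {u})"
      proof
        fix y assume y: "y \<in> Poly_Mapping.keys f' - N"
        then obtain u' where u': "y = u' + v" "u' \<in> Poly_Mapping.keys f"
          using Poly_Mapping.keys_mult[of f "Poly_Mapping.single v 1"] by (auto simp: f'_def)
        moreover have "u' \<notin> N" using y u' upsetD[OF up, of u' v] by auto
        moreover have "u' \<noteq> u" using y u' vu by (auto simp: add.commute)
        ultimately show "y \<in> (\<lambda>u'. u' + v) ` (Poly_Mapping.keys f - N - {u})" by blast
      qed
      then have "card (Poly_Mapping.keys f' - N) \<le> card (Poly_Mapping.keys f - N - {u})"
        by (rule surj_card_le[rotated]) simp
      also have "\<dots> < card (Poly_Mapping.keys f - N)"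
        using u by (intro card_Diff1_less) auto
      finally show ?thesis .
    qed
    ultimately show False using less.hyps nm by blast
  qed
qed

text \<open>
  Let \<open>P = I : f\<close> be generated by the variables in \<open>A\<close>.  If each term \<open>u\<close> of \<open>f\<close> had a multiplier off
  \<open>A\<close> taking it into \<open>N\<close>, the product of these multipliers would lie in \<open>P\<close>, although it involves no
  variable of \<open>A\<close>.  So some \<open>u\<close> has no such multiplier, and the part of \<open>u\<close> in \<open>A\<close> is in the socle.
  Conversely, for \<open>s\<close> in the socle, the multipliers off \<open>A\<close> that take the products \<open>s x\<^sub>i\<close> into \<open>N\<close>
  can be collected into one monomial \<open>u\<close> above \<open>s\<close>, and its annihilator is the prime generated by \<open>A\<close>.
\<close>

lemma Ass_poly_span:
  fixes N :: "('x::finite \<Rightarrow>\<^sub>0 nat) set"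
  assumes up: "upset UNIV N"
  shows "Ass (polyring UNIV) (poly_span N :: ('x, 'k::field) mpoly set) =
    var_ideal ` {A. socle_exps N A \<noteq> {}}"
proof -
  have Ass: "P \<in> Ass (polyring UNIV) (poly_span N) \<longleftrightarrow>
      primeideal P (polyring UNIV) \<and> (\<exists>f. P = {s. s * f \<in> poly_span N})"
    for P :: "('x, 'k) mpoly set"
    using Ass_iff[OF cring_polyring ideal_poly_span[OF up], of P] by simp
  show ?thesis
  proof (intro equalityI subsetI)
    fix P :: "('x, 'k) mpoly set" assume "P \<in> Ass (polyring UNIV) (poly_span N)"
    then obtain f where P: "primeideal P (polyring UNIV)" and Pf: "P = {s. s * f \<in> poly_span N}"
      by (auto simp: Ass)
    define A where "A = vars_in P"
    have PA: "P = var_ideal A"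
      unfolding A_def
      by (rule prime_eq_var_idealI[OF P]) (rule prime_annihilator_monomial[OF P up Pf])
    have mem: "m + u \<in> N" if "0 < deg_in A m" "u \<in> Poly_Mapping.keys f" for m u
    proof -
      have "Poly_Mapping.single m 1 \<in> P" using that by (simp add: PA var_ideal_def Suc_le_eq)
      then have "f * Poly_Mapping.single m 1 \<in> poly_span N" using Pf by (simp add: mult.commute)
      then have "u + m \<in> N" using that(2) by (simp add: mult_single_in_poly_span_iff)
      then show ?thesis by (simp add: add.commute)
    qed
    have "\<exists>u\<in>Poly_Mapping.keys f. \<forall>v\<in>exps (- A). v + u \<notin> N"
    proof (rule ccontr)
      assume "\<not> ?thesis"
      then obtain v where v: "\<And>u. u \<in> Poly_Mapping.keys f \<Longrightarrow> v u \<in> exps (- A) \<and> v u + u \<in> N"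
        by metis
      define w where "w = (\<Sum>u\<in>Poly_Mapping.keys f. v u)"
      have "u + w \<in> N" if u: "u \<in> Poly_Mapping.keys f" for u
      proof -
        have "w = v u + (\<Sum>u\<in>Poly_Mapping.keys f - {u}. v u)"
          unfolding w_def using u by (simp add: sum.remove)
        then show ?thesis
          using upsetD[OF up conjunct2[OF v[OF u]], of "\<Sum>u\<in>Poly_Mapping.keys f - {u}. v u"]
          by (simp add: ac_simps)
      qed
      then have "Poly_Mapping.single w 1 \<in> P"
        by (simp add: Pf mult.commute[of _ f] mult_single_in_poly_span_iff)
      then have "0 < deg_in A w" by (simp add: PA var_ideal_def Suc_le_eq)
      moreover have "w \<in> exps (- A)"
        using v by (auto simp: w_def exps_iff lookup_sum)
      ultimately show False by (simp flip: deg_in_eq_0)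
    qed
    then obtain u where u: "u \<in> Poly_Mapping.keys f" and off: "\<And>v. v \<in> exps (- A) \<Longrightarrow> v + u \<notin> N"
      by blast
    have "restrict_exp A u \<notin> local_exps N A"
    proof
      assume "restrict_exp A u \<in> local_exps N A"
      then obtain v where v: "v \<in> exps (- A)" "restrict_exp A u + v \<in> N"
        by (auto simp: local_exps_def)
      have "v + u = (restrict_exp A u + v) + restrict_exp (- A) u"
        using restrict_exp_add_Compl[of A u] by (simp add: ac_simps)
      also have "\<dots> \<in> N" using upsetD[OF up v(2)] by simp
      finally show False using off[OF v(1)] by simp
    qed
    moreover have "restrict_exp A u + unit_exp i \<in> local_exps N A" if i: "i \<in> A" for i
    proof -
      have "restrict_exp A u + unit_exp i + restrict_exp (- A) u = unit_exp i + u"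
        using restrict_exp_add_Compl[of A u] by (simp add: ac_simps)
      also have "\<dots> \<in> N" using mem[of "unit_exp i" u] i u by simp
      finally show ?thesis
        using i by (auto simp: local_exps_def intro!: exp_on_in_exps)
    qed
    ultimately have "restrict_exp A u \<in> socle_exps N A"
      by (auto simp: socle_exps_def intro!: exp_on_in_exps)
    with PA show "P \<in> var_ideal ` {A. socle_exps N A \<noteq> {}}" by blast
  next
    fix P :: "('x, 'k) mpoly set" assume "P \<in> var_ideal ` {A. socle_exps N A \<noteq> {}}"
    then obtain A s where PA: "P = var_ideal A" and s: "s \<in> socle_exps N A" by blast
    obtain v where v: "\<And>i. i \<in> A \<Longrightarrow> v i \<in> exps (- A) \<and> s + unit_exp i + v i \<in> N"
      using s unfolding socle_exps_def local_exps_def by (auto, metis)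
    define u where "u = s + (\<Sum>i\<in>A. v i)"
    have "m + u \<in> N \<longleftrightarrow> 0 < deg_in A m" for m
    proof
      assume m: "m + u \<in> N"
      show "0 < deg_in A m"
      proof (rule ccontr)
        assume "\<not> 0 < deg_in A m"
        then have off: "m + (\<Sum>i\<in>A. v i) \<in> exps (- A)"
          using v by (auto simp: deg_in_eq_0 exps_iff lookup_add lookup_sum)
        have "s + (m + (\<Sum>i\<in>A. v i)) \<in> N" using m by (simp add: u_def ac_simps)
        with off s have "s \<in> local_exps N A"
          unfolding local_exps_def socle_exps_def by blast
        then show False using s by (simp add: socle_exps_def)
      qed
    next
      assume "0 < deg_in A m"
      then obtain i w where i: "i \<in> A" "m = w + unit_exp i" by (rule exp_splits_off_unit)
      have "m + u = (s + unit_exp i + v i) + (w + (\<Sum>i\<in>A - {i}. v i))"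
        using i by (simp add: u_def sum.remove[of A i] ac_simps)
      also have "\<dots> \<in> N" using upsetD[OF up] v[OF i(1)] by simp
      finally show "m + u \<in> N" .
    qed
    then have "P = {s. s * Poly_Mapping.single u 1 \<in> poly_span N}"
      by (simp add: PA var_ideal_def mult_single_in_poly_span_iff)
        (auto simp: poly_span_def Suc_le_eq)
    then show "P \<in> Ass (polyring UNIV) (poly_span N)"
      using primeideal_var_ideal[of A, where 'k = 'k] PA by (auto simp: Ass)
  qed
qed

section \<open>Localization, saturation and socle\<close>

lemma poly_eval_loc:
  fixes f :: "('x::finite, 'k::comm_ring_1) mpoly"
  shows "poly_eval (\<lambda>i. if i \<in> A then var i else 1) f =
    (\<Sum>m\<in>Poly_Mapping.keys f. Poly_Mapping.single (restrict_exp A m) (Poly_Mapping.lookup f m))"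
proof -
  have power: "(var i :: ('x, 'k) mpoly) ^ k = Poly_Mapping.single (Poly_Mapping.single i k) 1" for i k
    by (induction k) (simp_all add: var_def mult_single flip: single_add)
  have prod: "(\<Prod>i\<in>K. Poly_Mapping.single (g i) (1 :: 'k)) = Poly_Mapping.single (\<Sum>i\<in>K. g i) 1"
    if "finite K" for K :: "'x set" and g :: "'x \<Rightarrow> 'x \<Rightarrow>\<^sub>0 nat"
    using that by (induction K) (simp_all add: mult_single)
  have "(\<Prod>i\<in>Poly_Mapping.keys m. (if i \<in> A then var i else 1) ^ Poly_Mapping.lookup m i) =
      Poly_Mapping.single (restrict_exp A m) (1 :: 'k)" for m :: "'x \<Rightarrow>\<^sub>0 nat"
  proof -
    have "(\<Prod>i\<in>Poly_Mapping.keys m. (if i \<in> A then var i else 1) ^ Poly_Mapping.lookup m i) =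
        (\<Prod>i\<in>Poly_Mapping.keys m. Poly_Mapping.single
          (if i \<in> A then Poly_Mapping.single i (Poly_Mapping.lookup m i) else 0) (1 :: 'k))"
      by (intro prod.cong refl) (auto simp: power)
    also have "\<dots> = Poly_Mapping.single (\<Sum>i\<in>Poly_Mapping.keys m.
          if i \<in> A then Poly_Mapping.single i (Poly_Mapping.lookup m i) else 0) 1"
      by (rule prod) simp
    also have "(\<Sum>i\<in>Poly_Mapping.keys m.
          if i \<in> A then Poly_Mapping.single i (Poly_Mapping.lookup m i) else 0) = restrict_exp A m"
      unfolding exp_on_def sum.inter_filter[symmetric, OF finite_keys]
      by (rule sum.mono_neutral_left) (auto simp: in_keys_iff intro: gr0I)
    finally show ?thesis .
  qed
  then show ?thesis by (simp add: poly_eval_def const_def mult_single)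
qed

lemma loc_ideal_var_ideal:
  fixes N :: "('x::finite \<Rightarrow>\<^sub>0 nat) set"
  shows "loc_ideal (poly_span N) (var_ideal A) =
    (poly_span (local_exps N A) :: ('x, 'k::comm_ring_1) mpoly set)"
proof -
  define \<phi> :: "('x, 'k) mpoly \<Rightarrow> ('x, 'k) mpoly" where "\<phi> f =
    (\<Sum>m\<in>Poly_Mapping.keys f. Poly_Mapping.single (restrict_exp A m) (Poly_Mapping.lookup f m))" for f
  have super: "\<phi> f = (\<Sum>m\<in>K. Poly_Mapping.single (restrict_exp A m) (Poly_Mapping.lookup f m))"
    if "finite K" "Poly_Mapping.keys f \<subseteq> K" for f K
    unfolding \<phi>_def using that by (intro sum.mono_neutral_left) (auto simp: in_keys_iff)
  have phi_add: "\<phi> (f + g) = \<phi> f + \<phi> g" for f g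
    using Poly_Mapping.keys_add[of f g]
    by (simp add: super[of "Poly_Mapping.keys f \<union> Poly_Mapping.keys g"] lookup_add single_add
        sum.distrib)
  have phi_zero: "\<phi> 0 = 0" by (simp add: \<phi>_def)
  have phi_single: "\<phi> (Poly_Mapping.single m c) = Poly_Mapping.single (restrict_exp A m) c" for m c
    by (simp add: super[of "{m}"])
  have "loc_ideal (poly_span N) (var_ideal A) = \<phi> ` poly_span N"
    by (simp add: loc_ideal_def poly_eval_loc \<phi>_def)
  also have "\<phi> ` poly_span N = poly_span (local_exps N A)"
  proof (intro equalityI subsetI)
    fix h assume "h \<in> \<phi> ` poly_span N"
    then obtain f where f: "f \<in> poly_span N" "h = \<phi> f" by blast
    from f(1) have "\<phi> f \<in> poly_span (local_exps N A)"
      by (induction rule: poly_span_induct)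
        (auto simp: phi_add phi_single restrict_exp_in_local_exps phi_zero intro: add_in_poly_span)
    with f show "h \<in> poly_span (local_exps N A)" by simp
  next
    fix h :: "('x, 'k) mpoly" assume "h \<in> poly_span (local_exps N A)"
    then show "h \<in> \<phi> ` poly_span N"
    proof (induction rule: poly_span_induct)
      case zero
      show ?case by (rule image_eqI[of _ _ 0]) (simp_all add: phi_zero)
    next
      case (add g h)
      then obtain g' h' where "g' \<in> poly_span N" "h' \<in> poly_span N" "g = \<phi> g'" "h = \<phi> h'"
        by blast
      then show ?case
        by (intro image_eqI[of _ _ "g' + h'"]) (simp_all add: phi_add add_in_poly_span)
    next
      case (single m c)
      then obtain v where "m \<in> exps A" "v \<in> exps (- A)" "m + v \<in> N"
        by (auto simp: local_exps_def)
      then have "Poly_Mapping.single m c = \<phi> (Poly_Mapping.single (m + v) c)"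
        "Poly_Mapping.single (m + v) c \<in> poly_span N"
        by (simp_all add: phi_single restrict_exp_add restrict_exp_in_exps restrict_exp_off)
      then show ?case by blast
    qed
  qed
  finally show ?thesis .
qed

lemma loc_max_ideal_var_ideal:
  "loc_max_ideal (var_ideal A) =
    (poly_span {m \<in> exps A. 1 \<le> deg_in A m} :: ('x::finite, 'k::comm_ring_1) mpoly set)"
  unfolding loc_max_ideal_def vars_in_var_ideal by (rule genideal_vars) simp

text \<open>
  A polynomial has finitely many terms and the sets \<open>S k\<close> increase with \<open>k\<close>, so one \<open>k\<close> serves for all
  its terms; this is why the union of the spans is the span of the union.
\<close>

lemma loc_saturation_var_ideal:
  fixes N :: "('x::finite \<Rightarrow>\<^sub>0 nat) set"
  shows "loc_saturation (poly_span N) (var_ideal A) =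
    (poly_span (sat_exps (local_exps N A) A) :: ('x, 'k::comm_ring_1) mpoly set)"
proof -
  define S where "S k = {m \<in> exps A. \<forall>q\<in>{m \<in> exps A. k \<le> deg_in A m}. m + q \<in> local_exps N A}" for k
  have mono: "S k \<subseteq> S l" if "k \<le> l" for k l
    using that by (auto simp: S_def)
  have "loc_saturation (poly_span N) (var_ideal A) = (\<Union>k. poly_span (S k) :: ('x, 'k) mpoly set)"
    by (simp add: loc_saturation_def ideal_saturation_def loc_ideal_var_ideal loc_max_ideal_var_ideal
        ideal_power_vars[of A A] ideal_colon_poly_span S_def del: One_nat_def)
  also have "\<dots> = poly_span (\<Union>k. S k)"
  proof (intro equalityI subsetI)
    fix f :: "('x, 'k) mpoly" assume "f \<in> poly_span (\<Union>k. S k)"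
    then have "\<forall>m\<in>Poly_Mapping.keys f. \<exists>k. m \<in> S k" by (auto simp: poly_span_def)
    then obtain k where k: "\<And>m. m \<in> Poly_Mapping.keys f \<Longrightarrow> m \<in> S (k m)" by metis
    have "m \<in> S (\<Sum>m\<in>Poly_Mapping.keys f. k m)" if "m \<in> Poly_Mapping.keys f" for m
      using k[OF that] mono[OF member_le_sum[OF that, of k]] by auto
    then show "f \<in> (\<Union>k. poly_span (S k))" by (auto simp: poly_span_def)
  qed (auto simp: poly_span_def)
  also have "(\<Union>k. S k) = sat_exps (local_exps N A) A"
    by (auto simp: S_def sat_exps_def)
  finally show ?thesis .
qed

text \<open>
  The colon ideal and \<open>I(\<pp>)\<close> are both spanned by monomials.  Hence a form of degree \<open>d\<close> in the colon
  ideal outside \<open>I(\<pp>)\<close> has a term with the same property, and this term is a socle exponent.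
\<close>

lemma soc_component_nonzero_iff:
  fixes N :: "('x::finite \<Rightarrow>\<^sub>0 nat) set" and A :: "'x set"
  assumes up: "upset UNIV N"
  defines "I \<equiv> (poly_span N :: ('x, 'k::field) mpoly set)" and "P \<equiv> var_ideal A"
  shows "soc_component I P d \<noteq> {\<zero>\<^bsub>loc_ring P Quot loc_ideal I P\<^esub>} \<longleftrightarrow> d \<in> deg_in A ` socle_exps N A"
proof -
  define M where "M = local_exps N A"
  have upM: "upset A M" unfolding M_def by (rule upset_local_exps[OF up])
  define C where "C = {m \<in> exps A. \<forall>q\<in>{m \<in> exps A. 1 \<le> deg_in A m}. m + q \<in> M}"
  define R where "R = (polyring A :: ('x, 'k) mpoly ring)"
  define L where "L = (poly_span M :: ('x, 'k) mpoly set)"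
  have MC: "M \<subseteq> C" using upM by (auto simp: C_def upset_def)
  have socle: "m \<in> socle_exps N A \<longleftrightarrow> m \<in> C \<and> m \<notin> M" for m
  proof
    assume m: "m \<in> socle_exps N A"
    have "m + q \<in> M" if q: "q \<in> exps A" "1 \<le> deg_in A q" for q
    proof -
      obtain i w where i: "i \<in> A" "q = w + unit_exp i"
        using exp_splits_off_unit[of A q] q(2) by auto
      have "m + unit_exp i + w \<in> M"
        using upsetD[OF upM] m i q(1) by (simp add: socle_exps_def M_def)
      then show ?thesis using i by (simp add: ac_simps)
    qed
    then show "m \<in> C \<and> m \<notin> M" using m by (simp add: socle_exps_def C_def M_def)
  next
    assume "m \<in> C \<and> m \<notin> M"
    then show "m \<in> socle_exps N A" by (simp add: socle_exps_def C_def M_def)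
  qed
  interpret cring R unfolding R_def by (rule cring_polyring)
  interpret L: ideal L R unfolding L_def R_def by (rule ideal_poly_span[OF upM])
  have R_simps [simp]: "carrier R = poly_span (exps A)" "add R = (+)" by (simp_all add: R_def)
  have C_sub: "(poly_span C :: ('x, 'k) mpoly set) \<subseteq> poly_span (exps A)"
    by (auto simp: poly_span_def C_def)
  have comp: "soc_component I P d = {c \<in> (\<lambda>f. L +>\<^bsub>R\<^esub> f) ` poly_span C.
      \<exists>f\<in>poly_span (exps A). homogeneous d f \<and> c = L +>\<^bsub>R\<^esub> f}"
    by (simp add: soc_component_def soc_def I_def P_def loc_ideal_var_ideal loc_max_ideal_var_ideal
        ideal_colon_poly_span L_def R_def M_def C_def del: One_nat_def)
  have zero: "\<zero>\<^bsub>loc_ring P Quot loc_ideal I P\<^esub> = L"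
    by (simp add: FactRing_def I_def P_def loc_ideal_var_ideal L_def M_def)
  have coset: "L +>\<^bsub>R\<^esub> f = L \<longleftrightarrow> f \<in> L" if "f \<in> poly_span (exps A)" for f
    using that L.a_rcos_const L.a_rcos_self[of f] by auto
  have "L \<in> soc_component I P d"
    unfolding comp using coset[of 0]
    by (auto intro!: image_eqI[of _ _ 0] bexI[of _ 0] simp: homogeneous_def L_def)
  then have "soc_component I P d \<noteq> {L} \<longleftrightarrow> (\<exists>c\<in>soc_component I P d. c \<noteq> L)" by blast
  also have "\<dots> \<longleftrightarrow> (\<exists>f\<in>poly_span C. homogeneous d f \<and> f \<notin> L)"
  proof
    assume "\<exists>c\<in>soc_component I P d. c \<noteq> L"
    then obtain f g where f: "f \<in> poly_span (exps A)" "homogeneous d f"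
      and g: "g \<in> poly_span C" and fg: "L +>\<^bsub>R\<^esub> f = L +>\<^bsub>R\<^esub> g" and ne: "L +>\<^bsub>R\<^esub> f \<noteq> L"
      unfolding comp by auto
    have "f \<in> L +>\<^bsub>R\<^esub> g" using L.a_rcos_self[of f] f fg by simp
    then obtain h where "h \<in> L" "f = h + g" by (auto simp: a_r_coset_def')
    then have "f \<in> poly_span C"
      using g MC poly_span_subset_iff[of M C, where 'k = 'k]
      by (auto simp: L_def intro!: add_in_poly_span)
    then show "\<exists>f\<in>poly_span C. homogeneous d f \<and> f \<notin> L"
      using f ne coset by blast
  next
    assume "\<exists>f\<in>poly_span C. homogeneous d f \<and> f \<notin> L"
    then obtain f where f: "f \<in> poly_span C" "homogeneous d f" "f \<notin> L" by blast
    then have "f \<in> poly_span (exps A)" using C_sub by blast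
    then have "L +>\<^bsub>R\<^esub> f \<in> soc_component I P d" "L +>\<^bsub>R\<^esub> f \<noteq> L"
      using f coset unfolding comp by blast+
    then show "\<exists>c\<in>soc_component I P d. c \<noteq> L" by blast
  qed
  also have "\<dots> \<longleftrightarrow> d \<in> deg_in A ` socle_exps N A"
  proof
    assume "\<exists>f\<in>poly_span C. homogeneous d f \<and> f \<notin> L"
    then obtain f where f: "f \<in> poly_span C" "homogeneous d f" and "f \<notin> L" by blast
    then obtain m where m: "m \<in> Poly_Mapping.keys f" "m \<notin> M" by (auto simp: L_def poly_span_def)
    have "m \<in> C" using f m by (auto simp: poly_span_def)
    moreover have "mdeg m = d" using f m by (simp add: homogeneous_def)
    ultimately show "d \<in> deg_in A ` socle_exps N A"
      using m by (auto simp: socle mdeg_eq_deg_in C_def)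
  next
    assume "d \<in> deg_in A ` socle_exps N A"
    then obtain m where m: "m \<in> C" "m \<notin> M" "d = deg_in A m" by (auto simp: socle)
    then have "homogeneous d (Poly_Mapping.single m (1 :: 'k))"
      by (simp add: homogeneous_def mdeg_eq_deg_in C_def)
    then show "\<exists>f\<in>poly_span C. homogeneous d f \<and> f \<notin> L"
      using m by (intro bexI[of _ "Poly_Mapping.single m 1"]) (auto simp: L_def)
  qed
  finally show ?thesis by (simp only: zero)
qed

lemma max_soc_var_ideal:
  fixes N :: "('x::finite \<Rightarrow>\<^sub>0 nat) set"
  assumes "upset UNIV N"
  shows "max_soc (poly_span N :: ('x, 'k::field) mpoly set) (var_ideal A) =
    Max (deg_in A ` socle_exps N A)"
  unfolding max_soc_def soc_component_nonzero_iff[OF assms] by simp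

lemma less_min_degree_poly_span_iff:
  fixes M :: "('x::finite \<Rightarrow>\<^sub>0 nat) set"
  shows "enat k < min_degree (poly_span M :: ('x, 'k::field) mpoly set) \<longleftrightarrow> (\<forall>m\<in>M. k < mdeg m)"
proof -
  have "{f \<in> (poly_span M :: ('x, 'k) mpoly set). homogeneous d f} \<noteq> {0} \<longleftrightarrow> d \<in> mdeg ` M" for d
  proof
    assume "{f \<in> (poly_span M :: ('x, 'k) mpoly set). homogeneous d f} \<noteq> {0}"
    moreover have "(0 :: ('x, 'k) mpoly) \<in> {f \<in> poly_span M. homogeneous d f}"
      by (simp add: homogeneous_def)
    ultimately obtain f :: "('x, 'k) mpoly" where f: "f \<in> poly_span M" "homogeneous d f" "f \<noteq> 0"
      by blast
    then obtain m where "m \<in> Poly_Mapping.keys f" by fastforce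
    with f show "d \<in> mdeg ` M" by (auto simp: poly_span_def homogeneous_def)
  next
    assume "d \<in> mdeg ` M"
    then obtain m where "m \<in> M" "d = mdeg m" by blast
    then have "Poly_Mapping.single m 1 \<in> {f \<in> (poly_span M :: ('x, 'k) mpoly set). homogeneous d f}"
      by (simp add: homogeneous_def)
    moreover have "Poly_Mapping.single m (1 :: 'k) \<noteq> 0"
      by (metis lookup_single_eq lookup_zero one_neq_zero)
    ultimately show "{f \<in> (poly_span M :: ('x, 'k) mpoly set). homogeneous d f} \<noteq> {0}" by blast
  qed
  then have "min_degree (poly_span M :: ('x, 'k) mpoly set) = Inf (enat ` mdeg ` M)"
    by (simp add: min_degree_def)
  then show ?thesis
    by (simp add: Suc_ile_eq[symmetric] le_Inf_iff image_image Suc_le_eq)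
qed

section \<open>The characterizations in terms of exponents\<close>

lemma less_min_degree_iff:
  fixes N :: "('x::finite \<Rightarrow>\<^sub>0 nat) set"
  assumes up: "upset UNIV N" and ne: "socle_exps N A \<noteq> {}"
  shows "enat (max_soc (poly_span N :: ('x, 'k::field) mpoly set) (var_ideal A)) <
      min_degree (loc_ideal (poly_span N :: ('x, 'k) mpoly set) (var_ideal A)) \<longleftrightarrow>
    (\<forall>m\<in>local_exps N A. \<forall>s\<in>socle_exps N A. deg_in A s < deg_in A m)"
proof -
  have "mdeg m = deg_in A m" if "m \<in> local_exps N A" for m
    using that by (simp add: local_exps_def mdeg_eq_deg_in)
  then show ?thesis
    using ne finite_socle_exps[OF up]
    by (simp add: loc_ideal_var_ideal max_soc_var_ideal[OF up] less_min_degree_poly_span_iff)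
qed

lemma loc_ideal_eq_saturation_cut_iff:
  fixes N :: "('x::finite \<Rightarrow>\<^sub>0 nat) set" and A :: "'x set"
  assumes up: "upset UNIV N" and ne: "socle_exps N A \<noteq> {}"
  defines "I \<equiv> (poly_span N :: ('x, 'k::field) mpoly set)" and "P \<equiv> var_ideal A"
  shows "(\<exists>a>0. loc_ideal I P = loc_saturation I P \<inter> ideal_power (loc_ring P) (loc_max_ideal P) a) \<longleftrightarrow>
    (\<forall>m\<in>local_exps N A. \<forall>s\<in>socle_exps N A. deg_in A s < deg_in A m)"
  unfolding I_def P_def loc_ideal_var_ideal loc_saturation_var_ideal loc_max_ideal_var_ideal
    vars_in_var_ideal ideal_power_vars[OF order_refl] poly_span_Int poly_span_eq_iff
  by (rule local_exps_eq_sat_cut_iff[OF up ne])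

lemma power_intersection_poly_span_iff:
  fixes N :: "('x::finite \<Rightarrow>\<^sub>0 nat) set"
  shows "power_intersection (poly_span N :: ('x, 'k::field) mpoly set) r p d \<longleftrightarrow>
    (\<exists>B. (\<forall>i\<in>{1..r}. p i = var_ideal (B i)) \<and> N = {m. \<forall>i\<in>{1..r}. d i \<le> deg_in (B i) m})"
proof -
  have eq: "(poly_span N :: ('x, 'k) mpoly set) = (\<Inter>i\<in>{1..r}. ideal_power (polyring UNIV) (p i) (d i)) \<longleftrightarrow>
      N = {m. \<forall>i\<in>{1..r}. d i \<le> deg_in (B i) m}"
    if "\<forall>i\<in>{1..r}. p i = var_ideal (B i)" for B
  proof -
    have "(\<Inter>i\<in>{1..r}. ideal_power (polyring UNIV) (p i) (d i)) =
        (poly_span {m. \<forall>i\<in>{1..r}. d i \<le> deg_in (B i) m} :: ('x, 'k) mpoly set)"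
      using that by (simp add: ideal_power_var_ideal poly_span_INT) (simp add: Collect_ball_eq)
    then show ?thesis by (simp only: poly_span_eq_iff)
  qed
  have "(\<forall>i\<in>{1..r}. monomial_prime_ideal (p i)) \<longleftrightarrow> (\<exists>B. \<forall>i\<in>{1..r}. p i = var_ideal (B i))"
    unfolding monomial_prime_ideal_iff by (rule bchoice_iff)
  then show ?thesis
    unfolding power_intersection_def using eq by blast
qed

theorem theorem1p1:
  fixes I :: "('x::finite, 'k::field) mpoly set"
  assumes "monomial_ideal I"
  shows "(((\<exists>r p d. power_intersection I r p d) \<longleftrightarrow>
           (\<forall>P\<in>Ass (polyring UNIV) I. \<exists>a>0.
              loc_ideal I P = loc_saturation I P \<inter> ideal_power (loc_ring P) (loc_max_ideal P) a)) \<and>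
          ((\<forall>P\<in>Ass (polyring UNIV) I. \<exists>a>0.
              loc_ideal I P = loc_saturation I P \<inter> ideal_power (loc_ring P) (loc_max_ideal P) a) \<longleftrightarrow>
           (\<forall>P\<in>Ass (polyring UNIV) I. min_degree (loc_ideal I P) > enat (max_soc I P)))) \<and>
         (\<forall>r p d. irredundant_power_intersection I r p d \<longrightarrow>
            Ass (polyring UNIV) I = p ` {1..r} \<and>
            (I \<noteq> {0} \<longrightarrow> (\<forall>i\<in>{1..r}. d i = max_soc I (p i) + 1)))"
proof -
  obtain N where up: "upset UNIV N" and I: "I = poly_span N"
    using monomial_ideal_eq_poly_span[OF assms] .
  let ?sep = "\<forall>A. \<forall>m\<in>local_exps N A. \<forall>s\<in>socle_exps N A. deg_in A s < deg_in A m"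
  have Ass: "Ass (polyring UNIV) I = var_ideal ` {A. socle_exps N A \<noteq> {}}"
    unfolding I by (rule Ass_poly_span[OF up])
  have ii: "(\<forall>P\<in>Ass (polyring UNIV) I. \<exists>a>0.
      loc_ideal I P = loc_saturation I P \<inter> ideal_power (loc_ring P) (loc_max_ideal P) a) \<longleftrightarrow> ?sep"
    unfolding Ass using loc_ideal_eq_saturation_cut_iff[OF up, where 'k = 'k] unfolding I by blast
  have iii: "(\<forall>P\<in>Ass (polyring UNIV) I. min_degree (loc_ideal I P) > enat (max_soc I P)) \<longleftrightarrow> ?sep"
    unfolding Ass using less_min_degree_iff[OF up, where 'k = 'k] unfolding I by blast
  have i: "(\<exists>r p d. power_intersection I r p d) \<longleftrightarrow> ?sep"
  proof
    assume "\<exists>r p d. power_intersection I r p d"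
    then obtain r p d where "power_intersection I r p d" by blast
    then obtain B where "N = {m. \<forall>i\<in>{1..r}. d i \<le> deg_in (B i) m}"
      unfolding I power_intersection_poly_span_iff by blast
    from presentation_imp_degrees_separated[OF this] show ?sep by blast
  next
    assume ?sep
    define \<A> where "\<A> = {A. socle_exps N A \<noteq> {}}"
    define a where "a A = Suc (Max (deg_in A ` socle_exps N A))" for A
    have N: "N = {m. \<forall>A\<in>\<A>. a A \<le> deg_in A m}"
      unfolding \<A>_def a_def using degrees_separated_imp_presentation[OF up] \<open>?sep\<close> by blast
    obtain n and e :: "nat \<Rightarrow> 'x set" where e: "\<A> = e ` {1..n}"
      using ex_bij_betw_nat_finite_1[of \<A>] by (auto simp: bij_betw_def)
    have "power_intersection I n (\<lambda>i. var_ideal (e i)) (\<lambda>i. a (e i))"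
      unfolding I power_intersection_poly_span_iff
      by (intro exI[of _ e] conjI) (simp_all add: N e)
    then show "\<exists>r p d. power_intersection I r p d" by blast
  qed
  have b: "Ass (polyring UNIV) I = p ` {1..r} \<and>
      (I \<noteq> {0} \<longrightarrow> (\<forall>i\<in>{1..r}. d i = max_soc I (p i) + 1))"
    if irr: "irredundant_power_intersection I r p d" for r p d
  proof -
    have "power_intersection I r p d" using irr by (simp add: irredundant_power_intersection_def)
    then obtain B where p: "\<And>i. i \<in> {1..r} \<Longrightarrow> p i = var_ideal (B i)"
      and N: "N = {m. \<forall>i\<in>{1..r}. d i \<le> deg_in (B i) m}"
      unfolding I power_intersection_poly_span_iff by blast
    have irr_N: "N \<noteq> {m. \<forall>l\<in>{1..r} - {j}. d l \<le> deg_in (B l) m}" if j: "j \<in> {1..r}" for j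
    proof
      assume eq: "N = {m. \<forall>l\<in>{1..r} - {j}. d l \<le> deg_in (B l) m}"
      have "(\<Inter>i\<in>{1..r} - {j}. ideal_power (polyring UNIV) (p i) (d i)) =
          (\<Inter>i\<in>{1..r} - {j}. poly_span {m. d i \<le> deg_in (B i) m})"
        using p by (intro INF_cong) (auto simp: ideal_power_var_ideal)
      also have "\<dots> = I"
        unfolding I eq poly_span_INT by (simp add: Collect_ball_eq)
      finally show False using irr j by (auto simp: irredundant_power_intersection_def)
    qed
    note S = irredundant_socle_exp[OF N finite_atLeastAtMost _ irr_N]
    have "{A. socle_exps N A \<noteq> {}} = B ` {1..r}"
      using S(1) socle_exp_presentation[OF N finite_atLeastAtMost] by (auto, metis imageI atLeastAtMost_iff)
    then have "Ass (polyring UNIV) I = p ` {1..r}"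
      unfolding Ass using p by (simp only: image_image cong: image_cong)
    moreover have "d i = max_soc I (p i) + 1" if "I \<noteq> {0}" "i \<in> {1..r}" for i
    proof -
      \<comment> \<open>The zero ideal is excluded here because its positive powers all coincide.\<close>
      have "N \<noteq> {}" using \<open>I \<noteq> {0}\<close> by (auto simp: I poly_span_def)
      then show ?thesis using S(2)[OF that(2) that(2)] p[OF that(2)] by (simp add: I max_soc_var_ideal[OF up])
    qed
    ultimately show ?thesis by blast
  qed
  show ?thesis using i ii iii b by blast
qed

end
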